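(* There exist an absolute constant $c>0$ and $T_0\in\mathbb N$ such that for all $T\ge T_0$ and every policy $\pi$, $$\sup_{(\theta^*,f,\mathcal D)}\mathbb E[R_T(\pi)]\ge c\,T^{2/3},$$ where the supremum is over valid single-index bandit instances (as defined in the context) with ambient dimension $d=1$, parameter $\theta^*=+1$, context distribution $\mathcal D=N(0,1)$, number of arms $K=\lceil 4N\log T/p_{\min}\rceil$ with $N=\lceil T^{1/3}\rceil$ and $p_{\min}=\phi(1)$, and $\mu^*\ge c_1/(2\log T)$.
   Context: Problem. At each round $t\in[T]=\{1,\dots,T\}$ the learner observes $K$ contexts $x_{t,a}$, $a\in[K]$, drawn i.i.d. (over $t$ and $a$) from $\mathcal D$, selects $a_t\in[K]$ as a (possibly randomized) function of the past observations and the current contexts (this rule is the policy $\pi$), and observes $y_t=f(x_{t,a_t}\theta^* )+\eta_t$ with $\eta_t\sim N(0,1)$ i.i.d. noise independent of the contexts. The regret is $R_T(\pi)=\sum_{t=1}^T\big(\max_{a\in[K]}f(x_{t,a}\theta^* )-f(x_{t,a_t}\theta^* )\big)$. Here $\phi$ is the standard Gaussian density and $\mu^*=\mathbb E[f'(X\theta^* )]$, $X\sim\mathcal D$. Valid instance (standard regularity conditions): the score $S(x)=-\frac{d}{dx}\log p(x)$ of the density $p$ of $\mathcal D$ satisfies $\mathbb E[S(X)^2]\le M$ (here $S(x)=x$, and $M=1$); $p$ is continuously differentiable and positive, $X$ is $1$-sub-Gaussian; $f:\mathbb R\to\mathbb R$ is continuously differentiable and $|f(z)|\le L_f$, $|f'(z)|\le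 L_{f'}$ for all $|z|\le C_W\sqrt{\log(dTK/\delta)}$, where $C_W$ is a universal constant, $\delta\in(0,1)$, and $L_f\ge1$, $L_{f'}\ge3$ are fixed constants. The constant $c_1$: fix a $C^\infty$ function $\rho:\mathbb R\to[0,1]$ with $\rho(z)=0$ for $z\le-1$, $\rho$ strictly increasing on $(-1,0)$, and $\rho(z)=1$ for $z\ge0$; then $c_1=\int_{-1}^0\rho'(x)\phi(x)\,dx>0$. *)

theory Defs
  imports "HOL-Probability.Probability"
begin

text \<open>
  Single-index bandits with one-dimensional contexts (ambient dimension \<open>DIM(real) = 1\<close>).
  Rounds are \<open>{1..T}\<close>, arms are \<open>{1..K}\<close>, and \<open>x t a\<close> is the context of arm \<open>a\<close> in round \<open>t\<close>.
\<close>

record sib_instance =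
  param :: real
  link :: "real \<Rightarrow> real"
  ctx_dist :: "real measure"

text \<open>What is recorded of a round: all its contexts, the selected arm, the reward.\<close>

type_synonym observation = "(nat \<Rightarrow> real) \<times> nat \<times> real"

text \<open>
  A policy receives the round, its internal randomness, the observations of the earlier rounds
  and the current contexts. The internal randomness is an i.i.d. sequence of uniform variables,
  all of which may be used in any round; so randomisation may be fresh in each round or shared
  between rounds.
\<close>

type_synonym policy =
  "nat \<Rightarrow> (nat \<Rightarrow> real) \<Rightarrow> (nat \<Rightarrow> observation) \<Rightarrow> (nat \<Rightarrow> real) \<Rightarrow> nat"

definition seed_measure :: "(nat \<Rightarrow> real) measure" where
  "seed_measure = PiM UNIV (\<lambda>_. uniform_measure lborel {0..1})"

definition context_space :: "nat \<Rightarrow> (nat \<Rightarrow> real) measure" where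
  "context_space K = PiM {1..K} (\<lambda>_. borel)"

definition history_space :: "nat \<Rightarrow> nat \<Rightarrow> (nat \<Rightarrow> observation) measure" where
  "history_space K n =
     PiM {1..n} (\<lambda>_. context_space K \<Otimes>\<^sub>M count_space {1..K} \<Otimes>\<^sub>M borel)"

definition is_policy :: "nat \<Rightarrow> nat \<Rightarrow> policy \<Rightarrow> bool" where
  "is_policy K T \<pi> \<longleftrightarrow>
     (\<forall>t\<in>{1..T}. (\<lambda>(u, h, x). \<pi> t u h x)
        \<in> seed_measure \<Otimes>\<^sub>M history_space K (t - 1) \<Otimes>\<^sub>M context_space K
            \<rightarrow>\<^sub>M count_space {1..K})"

primrec history ::
  "sib_instance \<Rightarrow> policy \<Rightarrow> (nat \<Rightarrow> real) \<Rightarrow> (nat \<Rightarrow> nat \<Rightarrow> real) \<Rightarrow> (nat \<Rightarrow> real)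
     \<Rightarrow> nat \<Rightarrow> (nat \<Rightarrow> observation)" where
  "history I \<pi> u x \<eta> 0 = (\<lambda>_. undefined)"
| "history I \<pi> u x \<eta> (Suc t) =
     (let h = history I \<pi> u x \<eta> t;
          a = \<pi> (Suc t) u h (x (Suc t))
      in h(Suc t := (x (Suc t), a, link I (x (Suc t) a * param I) + \<eta> (Suc t))))"

definition chosen_arm ::
  "sib_instance \<Rightarrow> policy \<Rightarrow> (nat \<Rightarrow> real) \<Rightarrow> (nat \<Rightarrow> nat \<Rightarrow> real) \<Rightarrow> (nat \<Rightarrow> real) \<Rightarrow> nat \<Rightarrow> nat"
where
  "chosen_arm I \<pi> u x \<eta> t = \<pi> t u (history I \<pi> u x \<eta> (t - 1)) (x t)"

definition regret ::
  "sib_instance \<Rightarrow> nat \<Rightarrow> nat \<Rightarrow> policy \<Rightarrow> (nat \<Rightarrow> real) \<Rightarrow> (nat \<Rightarrow> nat \<Rightarrow> real) \<Rightarrow> (nat \<Rightarrow> real)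
     \<Rightarrow> real" where
  "regret I K T \<pi> u x \<eta> =
     (\<Sum>t=1..T. Max ((\<lambda>a. link I (x t a * param I)) ` {1..K})
                 - link I (x t (chosen_arm I \<pi> u x \<eta> t) * param I))"

definition bandit_measure ::
  "sib_instance \<Rightarrow> nat \<Rightarrow> nat
     \<Rightarrow> ((nat \<Rightarrow> real) \<times> (nat \<Rightarrow> nat \<Rightarrow> real) \<times> (nat \<Rightarrow> real)) measure" where
  "bandit_measure I K T =
     seed_measure
     \<Otimes>\<^sub>M PiM {1..T} (\<lambda>_. PiM {1..K} (\<lambda>_. ctx_dist I))
     \<Otimes>\<^sub>M PiM {1..T} (\<lambda>_. density lborel std_normal_density)"

text \<open>The regret is nonnegative, so its expectation always exists as an extended nonnegative real.\<close>

definition expected_regret :: "sib_instance \<Rightarrow> nat \<Rightarrow> nat \<Rightarrow> policy \<Rightarrow> ennreal" where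
  "expected_regret I K T \<pi> =
     (\<integral>\<^sup>+(u, x, \<eta>). ennreal (regret I K T \<pi> u x \<eta>) \<partial>bandit_measure I K T)"

definition score :: "(real \<Rightarrow> real) \<Rightarrow> real \<Rightarrow> real" where
  "score p x = - deriv (\<lambda>z. ln (p z)) x"

definition one_sub_gaussian :: "real measure \<Rightarrow> bool" where
  "one_sub_gaussian D \<longleftrightarrow>
     (\<forall>s. integrable D (\<lambda>x. exp (s * x)) \<and> (\<integral>x. exp (s * x) \<partial>D) \<le> exp (s\<^sup>2 / 2))"

definition valid_ctx_dist :: "real \<Rightarrow> real measure \<Rightarrow> bool" where
  "valid_ctx_dist M D \<longleftrightarrow>
     prob_space D \<and> one_sub_gaussian D \<and>
     (\<exists>p. D = density lborel (\<lambda>x. ennreal (p x)) \<and> (\<forall>x. 0 < p x) \<and> p C1_differentiable_on UNIV \<and>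
          integrable D (\<lambda>x. (score p x)\<^sup>2) \<and> (\<integral>x. (score p x)\<^sup>2 \<partial>D) \<le> M)"

text \<open>Outside the window \<open>{-W..W}\<close> the link is only required to be continuously differentiable.\<close>

definition valid_link :: "real \<Rightarrow> real \<Rightarrow> real \<Rightarrow> (real \<Rightarrow> real) \<Rightarrow> bool" where
  "valid_link W L L' f \<longleftrightarrow>
     f C1_differentiable_on UNIV \<and> (\<forall>z. \<bar>z\<bar> \<le> W \<longrightarrow> \<bar>f z\<bar> \<le> L \<and> \<bar>deriv f z\<bar> \<le> L')"

definition valid_instance ::
  "real \<Rightarrow> real \<Rightarrow> real \<Rightarrow> real \<Rightarrow> real \<Rightarrow> nat \<Rightarrow> nat \<Rightarrow> sib_instance \<Rightarrow> bool" where
  "valid_instance M C\<^sub>W \<delta> L L' K T I \<longleftrightarrow>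
     valid_ctx_dist M (ctx_dist I) \<and>
     valid_link (C\<^sub>W * sqrt (ln (real DIM(real) * real T * real K / \<delta>))) L L' (link I)"

definition mu_star :: "sib_instance \<Rightarrow> real" where
  "mu_star I = (\<integral>x. deriv (link I) (x * param I) \<partial>ctx_dist I)"

definition is_transition :: "(real \<Rightarrow> real) \<Rightarrow> bool" where
  "is_transition \<rho> \<longleftrightarrow>
     (\<forall>n x. (deriv ^^ n) \<rho> differentiable (at x)) \<and>
     range \<rho> \<subseteq> {0..1} \<and>
     (\<forall>z\<le>-1. \<rho> z = 0) \<and> strict_mono_on {-1<..<0} \<rho> \<and> (\<forall>z\<ge>0. \<rho> z = 1)"

definition c\<^sub>1 :: "(real \<Rightarrow> real) \<Rightarrow> real" where
  "c\<^sub>1 \<rho> = (LBINT x:{-1..0}. deriv \<rho> x * std_normal_density x)"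

definition p_min :: real where
  "p_min = std_normal_density 1"

definition num_bumps :: "nat \<Rightarrow> nat" where
  "num_bumps T = nat \<lceil>real T powr (1/3)\<rceil>"

definition num_arms :: "nat \<Rightarrow> nat" where
  "num_arms T = nat \<lceil>4 * real (num_bumps T) * ln (real T) / p_min\<rceil>"

end

theory Submission
  imports Defs
begin

text \<open>
  Cut the interval from 0 to 1 into \<open>N\<close> bins of width \<open>1 / N\<close>, where \<open>N\<close> is about \<open>T\<close> to the power
  \<open>1/3\<close>. All links share one increasing ramp that is constant on the nonnegative half-line;
  the \<open>j\<close>-th link carries in addition a bump of height \<open>1 / (8 * N)\<close> supported in bin \<open>j\<close>. The ramp
  alone keeps \<open>\<mu>\<^sup>*\<close> bounded away from 0. There are so many arms that in almost
  every round some context lies in the core of bin \<open>j\<close>, so a round in which the policy does not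
  choose bin \<open>j\<close> costs at least half the height of the bump. Under the link without a bump the policy
  visits an average bin only \<open>T / N\<close> times. The squared height of the bump times \<open>T / N\<close> is a
  small constant, so the policy cannot tell that link from the \<open>j\<close>-th one, and for
  some \<open>j\<close> it misses bin \<open>j\<close> in a constant fraction of the rounds. The regret is then of order
  \<open>T / N\<close>.
\<close>

section \<open>Predictable shifts of Gaussian noise\<close>

text \<open>The data are collected adaptively, so the laws of the observations under two links are
  not product measures, and comparing them directly would call for a chain rule for conditional
  laws. Instead, seed and contexts are frozen, which makes the history a function of the Gaussian
  noise alone. Exchanging one link for another then amounts to shifting the noise by a drift that
  depends only on earlier noise; the likelihood ratio of such a shift is an explicit exponential,
  and elementary exponential inequalities take the place of divergences. Seed and contexts are
  integrated out only after summing over the bins. Two demands pull the links apart: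
  \<open>mu_star\<close> must stay away from 0, while the mean slope of a bump is negligible, and
  yet a bump must hold the best reward. Putting the ramp to the left of 0 reconciles them: it
  supplies the slope, and over the bins it already sits at its maximum 1/2, so no context outside
  bin \<open>j\<close> can exceed 1/2, wherever it lies.\<close>

declare One_nat_def [simp del]

abbreviation noise :: "nat \<Rightarrow> (nat \<Rightarrow> real) measure" where
  "noise n \<equiv> PiM {1..n} (\<lambda>_. std_normal_distribution)"

lemma prob_space_std_normal: "prob_space std_normal_distribution"
  by (rule prob_space_normal_density) simp

interpretation gauss: product_prob_space "\<lambda>_::nat. std_normal_distribution" "{1..n}" for n
  by (rule product_prob_spaceI) (rule prob_space_std_normal)

lemma measurable_noise_component [measurable]:
  "t \<in> {1..n} \<Longrightarrow> (\<lambda>\<eta>. \<eta> t) \<in> borel_measurable (noise n)"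
  using measurable_component_singleton[of t "{1..n}" "\<lambda>_. std_normal_distribution"] by simp

text \<open>Measurability on \<open>noise (t - 1)\<close> constrains \<open>b t\<close> only on
  extensional functions; invariance under restriction makes \<open>b t\<close> ignore the present
  and later noise on all functions.\<close>

definition predictable :: "nat \<Rightarrow> (nat \<Rightarrow> (nat \<Rightarrow> real) \<Rightarrow> real) \<Rightarrow> bool" where
  "predictable n b \<longleftrightarrow> (\<forall>t\<in>{1..n}.
     b t \<in> borel_measurable (noise (t - 1)) \<and> (\<forall>\<eta>. b t (restrict \<eta> {1..t - 1}) = b t \<eta>))"

text \<open>The discrete Girsanov density: the likelihood ratio of noise with conditional means
  \<open>b t\<close> against centred noise.\<close>

definition exp_tilt :: "nat \<Rightarrow> (nat \<Rightarrow> (nat \<Rightarrow> real) \<Rightarrow> real) \<Rightarrow> (nat \<Rightarrow> real) \<Rightarrow> real" where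
  "exp_tilt n b \<eta> = exp (\<Sum>t=1..n. b t \<eta> * \<eta> t - (b t \<eta>)\<^sup>2 / 2)"

text \<open>Restricted to \<open>{1..n}\<close> so that the result is extensional, as points of
  \<open>noise n\<close> must be.\<close>

definition unshift ::
  "nat \<Rightarrow> (nat \<Rightarrow> (nat \<Rightarrow> real) \<Rightarrow> real) \<Rightarrow> (nat \<Rightarrow> real) \<Rightarrow> nat \<Rightarrow> real" where
  "unshift n b \<eta> = (\<lambda>t\<in>{1..n}. \<eta> t - b t \<eta>)"

lemma exp_tilt_nonneg: "0 \<le> exp_tilt n b \<eta>"
  by (simp add: exp_tilt_def)

lemma predictable_mono: "predictable n b \<Longrightarrow> m \<le> n \<Longrightarrow> predictable m b"
  by (auto simp: predictable_def)

lemma predictable_scale: "predictable n b \<Longrightarrow> predictable n (\<lambda>t \<eta>. c * b t \<eta>)"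
  by (auto simp: predictable_def)

lemma predictable_measurable:
  assumes "predictable n b" "t \<in> {1..n}" "t \<le> Suc m"
  shows "b t \<in> borel_measurable (noise m)"
proof -
  have "(\<lambda>\<eta>. restrict \<eta> {1..t - 1}) \<in> noise m \<rightarrow>\<^sub>M noise (t - 1)"
    by (rule measurable_restrict_subset) (use assms in auto)
  moreover have "b t \<in> borel_measurable (noise (t - 1))"
    using assms unfolding predictable_def by auto
  ultimately have "(\<lambda>\<eta>. b t (restrict \<eta> {1..t - 1})) \<in> borel_measurable (noise m)"
    by (rule measurable_compose)
  moreover have "b t (restrict \<eta> {1..t - 1}) = b t \<eta>" for \<eta>
    using assms unfolding predictable_def by auto
  ultimately show ?thesis by simp
qed

lemma predictable_update:
  assumes "predictable n b" "t \<in> {1..n}" "t \<le> i"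
  shows "b t (\<eta>(i := y)) = b t \<eta>"
proof -
  have eq: "b t (restrict \<eta> {1..t - 1}) = b t \<eta>" for \<eta>
    using assms unfolding predictable_def by auto
  have "restrict (\<eta>(i := y)) {1..t - 1} = restrict \<eta> {1..t - 1}"
    using assms by (auto simp: restrict_def fun_eq_iff)
  then show ?thesis using eq by metis
qed

lemma measurable_exp_tilt [measurable]:
  assumes "predictable n b"
  shows "exp_tilt n b \<in> borel_measurable (noise n)"
proof -
  have "b t \<in> borel_measurable (noise n)" if "t \<in> {1..n}" for t
    using predictable_measurable[OF assms that] that by auto
  then show ?thesis unfolding exp_tilt_def by measurable
qed

lemma measurable_unshift:
  assumes "predictable n b"
  shows "unshift n b \<in> noise n \<rightarrow>\<^sub>M noise n"
proof -
  have "(\<lambda>\<eta>. \<eta> t - b t \<eta>) \<in> noise n \<rightarrow>\<^sub>M std_normal_distribution" if t: "t \<in> {1..n}" for t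
    using borel_measurable_diff[OF measurable_noise_component[OF t]
        predictable_measurable[OF assms t, of n]] t by simp
  then show ?thesis
    unfolding unshift_def by (rule measurable_restrict)
qed

text \<open>Completing the square turns the tilted density into the Gaussian density centred at
  \<open>c\<close>; translation invariance of Lebesgue measure does the rest.\<close>

lemma nn_integral_std_normal_shift:
  assumes [measurable]: "H \<in> borel_measurable borel"
  shows "(\<integral>\<^sup>+y. H (y - c) * ennreal (exp (c * y - c\<^sup>2 / 2)) \<partial>std_normal_distribution) = (\<integral>\<^sup>+y. H y \<partial>std_normal_distribution)"
proof -
  have dens: "std_normal_density y * exp (c * y - c\<^sup>2 / 2) = std_normal_density (y - c)" for y
    unfolding std_normal_density_def
    by (simp add: exp_add[symmetric] power2_eq_square field_simps)
  have "(\<integral>\<^sup>+y. H (y - c) * ennreal (exp (c * y - c\<^sup>2 / 2)) \<partial>std_normal_distribution)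
      = (\<integral>\<^sup>+y. ennreal (std_normal_density y * exp (c * y - c\<^sup>2 / 2)) * H (y - c) \<partial>lborel)"
    by (subst nn_integral_density) (auto simp: ennreal_mult mult_ac)
  also have "\<dots> = (\<integral>\<^sup>+y. ennreal (std_normal_density (y - c)) * H (y - c) \<partial>lborel)"
    by (simp add: dens)
  also have "\<dots> = (\<integral>\<^sup>+y. ennreal (std_normal_density y) * H y \<partial>lborel)"
    by (subst nn_integral_real_affine[of _ 1 c]) auto
  also have "\<dots> = (\<integral>\<^sup>+y. H y \<partial>std_normal_distribution)"
    by (subst nn_integral_density) auto
  finally show ?thesis .
qed

lemma atLeastAtMost_Un_Suc: "{1..Suc n} = {1..n} \<union> {Suc n}"
  by auto

lemma atLeastAtMost_insert_Suc: "{1..Suc n} = insert (Suc n) {1..n}"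
  by auto

text \<open>Girsanov's theorem in discrete time. The last noise coordinate is peeled off: no drift
  term depends on it, so with the others frozen it undergoes a constant shift. \<open>H\<close> is
  arbitrary because the induction hypothesis is applied to \<open>H\<close> with its last coordinate
  integrated out.\<close>

lemma nn_integral_unshift:
  assumes "predictable n b" "H \<in> borel_measurable (noise n)"
  shows "(\<integral>\<^sup>+\<eta>. H (unshift n b \<eta>) * ennreal (exp_tilt n b \<eta>) \<partial>noise n) = (\<integral>\<^sup>+\<eta>. H \<eta> \<partial>noise n)"
  using assms
proof (induction n arbitrary: H)
  case 0
  then show ?case by (simp add: exp_tilt_def unshift_def PiM_empty nn_integral_count_space_finite)
next
  case (Suc n)
  note b = \<open>predictable (Suc n) b\<close>
  note [measurable] = Suc.prems(2)
  have bn: "predictable n b" using predictable_mono[OF b, of n] by simp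
  have un: "unshift (Suc n) b (\<eta>(Suc n := y)) = (unshift n b \<eta>)(Suc n := y - b (Suc n) \<eta>)" for \<eta> y
    using predictable_update[OF b, of _ "Suc n" \<eta> y] by (auto simp: unshift_def fun_eq_iff restrict_def)
  have tilt: "exp_tilt (Suc n) b (\<eta>(Suc n := y))
      = exp_tilt n b \<eta> * exp (b (Suc n) \<eta> * y - (b (Suc n) \<eta>)\<^sup>2 / 2)" for \<eta> y
    using predictable_update[OF b, of _ "Suc n" \<eta> y]
    by (simp add: exp_tilt_def exp_add[symmetric])
  have m1: "(\<lambda>\<eta>. H (unshift (Suc n) b \<eta>) * ennreal (exp_tilt (Suc n) b \<eta>)) \<in> borel_measurable (noise (Suc n))"
    using measurable_unshift[OF b] measurable_exp_tilt[OF b] by measurable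
  have m2: "(\<lambda>y. H (\<eta>(Suc n := y))) \<in> borel_measurable borel" if "\<eta> \<in> space (noise n)" for \<eta>
  proof -
    have "(\<lambda>y. \<eta>(Suc n := y)) \<in> std_normal_distribution \<rightarrow>\<^sub>M noise (Suc n)"
      unfolding atLeastAtMost_insert_Suc
      by (rule measurable_component_update) (use that in auto)
    then have "(\<lambda>y. H (\<eta>(Suc n := y))) \<in> borel_measurable std_normal_distribution"
      by measurable
    then show ?thesis by simp
  qed
  \<comment> \<open>This integral is the function that takes the place of \<open>H\<close> in the
    induction hypothesis.\<close>
  have m3: "(\<lambda>\<eta>. \<integral>\<^sup>+y. H (\<eta>(Suc n := y)) \<partial>std_normal_distribution) \<in> borel_measurable (noise n)"
  proof (rule sigma_finite_measure.borel_measurable_nn_integral)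
    show "sigma_finite_measure std_normal_distribution" 
      using prob_space_std_normal prob_space_imp_sigma_finite by blast
    have "(\<lambda>(\<eta>, y). \<eta>(Suc n := y)) \<in> noise n \<Otimes>\<^sub>M std_normal_distribution \<rightarrow>\<^sub>M noise (Suc n)"
      unfolding atLeastAtMost_insert_Suc by (rule measurable_add_dim)
    then show "(\<lambda>(\<eta>, y). H (\<eta>(Suc n := y))) \<in> borel_measurable (noise n \<Otimes>\<^sub>M std_normal_distribution)"
      using measurable_compose[OF _ Suc.prems(2)] by (simp add: case_prod_beta')
  qed
  have "(\<integral>\<^sup>+\<eta>. H (unshift (Suc n) b \<eta>) * ennreal (exp_tilt (Suc n) b \<eta>) \<partial>noise (Suc n))
     = (\<integral>\<^sup>+\<eta>. \<integral>\<^sup>+y. H ((unshift n b \<eta>)(Suc n := y - b (Suc n) \<eta>)) *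
          (ennreal (exp (b (Suc n) \<eta> * y - (b (Suc n) \<eta>)\<^sup>2 / 2)) * ennreal (exp_tilt n b \<eta>))
          \<partial>std_normal_distribution \<partial>noise n)"
    using m1 unfolding atLeastAtMost_insert_Suc
    by (subst gauss.product_nn_integral_insert)
      (auto simp: un tilt ennreal_mult exp_tilt_nonneg mult_ac)
  also have "\<dots> = (\<integral>\<^sup>+\<eta>. (\<integral>\<^sup>+y. H ((unshift n b \<eta>)(Suc n := y)) \<partial>std_normal_distribution)
       * ennreal (exp_tilt n b \<eta>) \<partial>noise n)"
  proof (rule nn_integral_cong)
    fix \<eta> assume "\<eta> \<in> space (noise n)"
    then have "unshift n b \<eta> \<in> space (noise n)"
      using measurable_space[OF measurable_unshift[OF bn]] by auto
    note m = m2[OF this]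
    have m': "(\<lambda>y. H ((unshift n b \<eta>)(Suc n := y - b (Suc n) \<eta>))) \<in> borel_measurable borel"
      using measurable_compose[OF _ m, of "\<lambda>y. y - b (Suc n) \<eta>"] by simp
    show "(\<integral>\<^sup>+y. H ((unshift n b \<eta>)(Suc n := y - b (Suc n) \<eta>)) *
          (ennreal (exp (b (Suc n) \<eta> * y - (b (Suc n) \<eta>)\<^sup>2 / 2)) * ennreal (exp_tilt n b \<eta>))
          \<partial>std_normal_distribution) = (\<integral>\<^sup>+y. H ((unshift n b \<eta>)(Suc n := y)) \<partial>std_normal_distribution)
       * ennreal (exp_tilt n b \<eta>)"
      unfolding nn_integral_std_normal_shift[OF m, symmetric, of "b (Suc n) \<eta>"]
      using m' by (subst nn_integral_multc[symmetric]) (auto simp: mult_ac)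
  qed
  also have "\<dots> = (\<integral>\<^sup>+\<eta>. \<integral>\<^sup>+y. H (\<eta>(Suc n := y)) \<partial>std_normal_distribution \<partial>noise n)"
    by (rule Suc.IH[OF bn m3])
  also have "\<dots> = (\<integral>\<^sup>+\<eta>. H \<eta> \<partial>noise (Suc n))"
    using Suc.prems(2) unfolding atLeastAtMost_insert_Suc
    by (subst gauss.product_nn_integral_insert) auto
  finally show ?case .
qed

lemma nn_integral_exp_tilt:
  assumes "predictable n b"
  shows "(\<integral>\<^sup>+\<eta>. ennreal (exp_tilt n b \<eta>) \<partial>noise n) = 1"
  using nn_integral_unshift[OF assms, of "\<lambda>_. 1"] gauss.P.emeasure_space_1 by simp

text \<open>
  The density \<open>exp (M - V / 2)\<close> is at least \<open>1 - \<bar>M\<bar> - V / 2\<close>, and \<open>1 + x \<le> exp x\<close> also bounds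
  \<open>l * \<bar>M\<bar>\<close> through the exponential tilts by \<open>l * b\<close> and \<open>- l * b\<close>, which both have mass 1.
  So the change of measure costs only the expected quadratic variation of the drift \<open>b\<close>.
\<close>

lemma predictable_shift_comparison:
  fixes H :: "(nat \<Rightarrow> real) \<Rightarrow> real"
  assumes b: "predictable n b" and H [measurable]: "H \<in> borel_measurable (noise n)"
    and H01: "\<And>\<eta>. 0 \<le> H \<eta> \<and> H \<eta> \<le> 1" and l: "l > 0"
  shows "(\<integral>\<^sup>+\<eta>. ennreal (H (unshift n b \<eta>)) \<partial>noise n)
     \<le> (\<integral>\<^sup>+\<eta>. ennreal (H \<eta>) \<partial>noise n) + ennreal (1 / l)
        + ennreal ((l + 1) / 2) * (\<integral>\<^sup>+\<eta>. ennreal (\<Sum>t=1..n. (b t \<eta>)\<^sup>2) \<partial>noise n)"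
proof -
  define V where "V \<eta> = (\<Sum>t=1..n. (b t \<eta>)\<^sup>2)" for \<eta>
  define M where "M \<eta> = (\<Sum>t=1..n. b t \<eta> * \<eta> t)" for \<eta>
  define G where "G \<eta> = H (unshift n b \<eta>)" for \<eta>
  have V0: "V \<eta> \<ge> 0" for \<eta> by (simp add: V_def sum_nonneg)
  have G01: "0 \<le> G \<eta>" "G \<eta> \<le> 1" for \<eta> using H01 by (auto simp: G_def)
  have tilt: "exp_tilt n (\<lambda>t \<eta>. c * b t \<eta>) \<eta> = exp (c * M \<eta> - c\<^sup>2 * V \<eta> / 2)" for c \<eta>
    by (simp add: exp_tilt_def V_def M_def sum_subtractf sum_distrib_left power_mult_distrib
        sum_divide_distrib mult_ac)
  have tilt1: "exp_tilt n b \<eta> = exp (M \<eta> - V \<eta> / 2)" for \<eta>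
    using tilt[of 1] by simp
  have bm [measurable]: "b t \<in> borel_measurable (noise n)" if "t \<in> {1..n}" for t
    using predictable_measurable[OF b that] that by auto
  have [measurable]: "M \<in> borel_measurable (noise n)" "V \<in> borel_measurable (noise n)"
    unfolding M_def V_def by measurable
  have [measurable]: "G \<in> borel_measurable (noise n)"
    unfolding G_def using measurable_unshift[OF b] by measurable
  \<comment> \<open>The term \<open>1 / l\<close> on the left is kept on purpose: the two tilts on
    the right integrate to \<open>2 / l\<close>, and cancelling leaves a single \<open>1 / l\<close>
    in the result.\<close>
  have le: "G \<eta> + 1 / l \<le> G \<eta> * exp (M \<eta> - V \<eta> / 2)
      + 1 / l * (exp (l * M \<eta> - l\<^sup>2 * V \<eta> / 2) + exp (- l * M \<eta> - l\<^sup>2 * V \<eta> / 2))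
      + (l + 1) / 2 * V \<eta>" for \<eta>
  proof -
    have "1 + (M \<eta> - V \<eta> / 2) \<le> exp (M \<eta> - V \<eta> / 2)" by simp
    then have "G \<eta> * (1 + (M \<eta> - V \<eta> / 2)) \<le> G \<eta> * exp (M \<eta> - V \<eta> / 2)"
      by (rule mult_left_mono) (rule G01)
    moreover have "G \<eta> * (\<bar>M \<eta>\<bar> + V \<eta> / 2) \<le> 1 * (\<bar>M \<eta>\<bar> + V \<eta> / 2)"
      by (rule mult_right_mono) (use V0[of \<eta>] G01 in auto)
    moreover have "G \<eta> * (M \<eta> - V \<eta> / 2) \<ge> - (G \<eta> * (\<bar>M \<eta>\<bar> + V \<eta> / 2))"
      using mult_left_mono[OF _ G01(1)[of \<eta>], of "- (\<bar>M \<eta>\<bar> + V \<eta> / 2)" "M \<eta> - V \<eta> / 2"]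
      by (simp add: algebra_simps)
    ultimately have 1: "G \<eta> \<le> G \<eta> * exp (M \<eta> - V \<eta> / 2) + \<bar>M \<eta>\<bar> + V \<eta> / 2"
      by (simp add: algebra_simps)
    have "1 + (l * \<bar>M \<eta>\<bar> - l\<^sup>2 * V \<eta> / 2) \<le> exp (l * \<bar>M \<eta>\<bar> - l\<^sup>2 * V \<eta> / 2)" by simp
    also have "\<dots> \<le> exp (l * M \<eta> - l\<^sup>2 * V \<eta> / 2) + exp (- l * M \<eta> - l\<^sup>2 * V \<eta> / 2)"
      by (cases "M \<eta> \<ge> 0") auto
    finally have "1 / l * (1 + (l * \<bar>M \<eta>\<bar> - l\<^sup>2 * V \<eta> / 2)) \<le>
        1 / l * (exp (l * M \<eta> - l\<^sup>2 * V \<eta> / 2) + exp (- l * M \<eta> - l\<^sup>2 * V \<eta> / 2))"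
      by (rule mult_left_mono) (use l in auto)
    moreover have "1 / l * (1 + (l * \<bar>M \<eta>\<bar> - l\<^sup>2 * V \<eta> / 2)) = 1 / l + \<bar>M \<eta>\<bar> - l * V \<eta> / 2"
      using l by (simp add: field_simps power2_eq_square)
    moreover have "(l + 1) / 2 * V \<eta> = l * V \<eta> / 2 + V \<eta> / 2"
      by (simp add: field_simps)
    ultimately show ?thesis using 1 by linarith
  qed
  \<comment> \<open>\<open>G\<close> is \<open>H\<close> after \<open>unshift\<close>, so the tilt
    turns its integral back into that of \<open>H\<close>.\<close>
  have i1: "(\<integral>\<^sup>+\<eta>. ennreal (G \<eta> * exp (M \<eta> - V \<eta> / 2)) \<partial>noise n) = (\<integral>\<^sup>+\<eta>. ennreal (H \<eta>) \<partial>noise n)"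
    using nn_integral_unshift[OF b measurable_compose[OF H measurable_ennreal]]
    by (simp add: tilt1 ennreal_mult' G_def H01)
  have i2: "(\<integral>\<^sup>+\<eta>. ennreal (exp (c * M \<eta> - c\<^sup>2 * V \<eta> / 2)) \<partial>noise n) = 1" for c
    using nn_integral_exp_tilt[OF predictable_scale[OF b, of c]] by (simp add: tilt)
  have "(\<integral>\<^sup>+\<eta>. ennreal (G \<eta>) \<partial>noise n) + ennreal (1 / l)
      = (\<integral>\<^sup>+\<eta>. ennreal (G \<eta>) + ennreal (1 / l) \<partial>noise n)"
    by (subst nn_integral_add) (auto simp: gauss.P.emeasure_space_1)
  also have "\<dots> \<le> (\<integral>\<^sup>+\<eta>. ennreal (G \<eta> * exp (M \<eta> - V \<eta> / 2))
      + ennreal (1 / l) * (ennreal (exp (l * M \<eta> - l\<^sup>2 * V \<eta> / 2))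
            + ennreal (exp ((- l) * M \<eta> - (- l)\<^sup>2 * V \<eta> / 2)))
      + ennreal ((l + 1) / 2) * ennreal (V \<eta>) \<partial>noise n)"
  proof (rule nn_integral_mono)
    fix \<eta>
    show "ennreal (G \<eta>) + ennreal (1 / l) \<le> ennreal (G \<eta> * exp (M \<eta> - V \<eta> / 2))
      + ennreal (1 / l) * (ennreal (exp (l * M \<eta> - l\<^sup>2 * V \<eta> / 2))
            + ennreal (exp ((- l) * M \<eta> - (- l)\<^sup>2 * V \<eta> / 2)))
      + ennreal ((l + 1) / 2) * ennreal (V \<eta>)"
      using ennreal_leI[OF le[of \<eta>]] l G01[of \<eta>] V0[of \<eta>]
      by (simp add: ennreal_plus[symmetric] ennreal_mult[symmetric] del: ennreal_plus)
  qed
  also have "\<dots> = (\<integral>\<^sup>+\<eta>. ennreal (H \<eta>) \<partial>noise n) + ennreal (1 / l) * (1 + 1)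
      + ennreal ((l + 1) / 2) * (\<integral>\<^sup>+\<eta>. ennreal (V \<eta>) \<partial>noise n)"
    using i2[of "- l"] by (simp add: nn_integral_add nn_integral_cmult i1 i2)
  also have "\<dots> = ((\<integral>\<^sup>+\<eta>. ennreal (H \<eta>) \<partial>noise n) + ennreal (1 / l)
      + ennreal ((l + 1) / 2) * (\<integral>\<^sup>+\<eta>. ennreal (V \<eta>) \<partial>noise n)) + ennreal (1 / l)"
    by (simp add: mult_2_right add_ac)
  finally show ?thesis
    unfolding G_def V_def by (simp add: add.commute[of _ "ennreal (1 / l)"] ennreal_add_left_cancel_le)
qed

section \<open>Histories under shifted noise\<close>

lemma history_cong:
  "(\<And>i. i \<in> {1..t} \<Longrightarrow> \<eta> i = \<eta>' i) \<Longrightarrow> history I \<pi> u x \<eta> t = history I \<pi> u x \<eta>' t"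
  by (induction t) (auto simp: Let_def)

lemma chosen_arm_cong:
  "(\<And>i. i \<in> {1..t - 1} \<Longrightarrow> \<eta> i = \<eta>' i) \<Longrightarrow> chosen_arm I \<pi> u x \<eta> t = chosen_arm I \<pi> u x \<eta>' t"
  unfolding chosen_arm_def using history_cong by metis

text \<open>
  Lowering each noise term by the excess of the link of \<open>J\<close> over that of \<open>I\<close> at the chosen
  arm leaves every reward, and hence every choice, as it was under \<open>I\<close>.
\<close>

lemma history_unshift:
  assumes b: "\<And>t. t \<in> {1..n} \<Longrightarrow> b t \<eta> =
      link J (x t (chosen_arm I \<pi> u x \<eta> t) * param J) - link I (x t (chosen_arm I \<pi> u x \<eta> t) * param I)"
    and "t \<le> n"
  shows "history J \<pi> u x (unshift n b \<eta>) t = history I \<pi> u x \<eta> t"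
  using \<open>t \<le> n\<close>
proof (induction t)
  case (Suc t)
  then show ?case
    using b[of "Suc t"] by (simp add: Let_def unshift_def chosen_arm_def add.commute)
qed simp

lemma chosen_arm_unshift:
  assumes "\<And>t. t \<in> {1..n} \<Longrightarrow> b t \<eta> =
      link J (x t (chosen_arm I \<pi> u x \<eta> t) * param J) - link I (x t (chosen_arm I \<pi> u x \<eta> t) * param I)"
    and "t \<in> {1..n}"
  shows "chosen_arm J \<pi> u x (unshift n b \<eta>) t = chosen_arm I \<pi> u x \<eta> t"
proof -
  have "history J \<pi> u x (unshift n b \<eta>) (t - 1) = history I \<pi> u x \<eta> (t - 1)"
    by (rule history_unshift[where n = n and b = b and \<eta> = \<eta> and x = x and I = I and J = J])
      (use assms in auto)
  then show ?thesis by (simp add: chosen_arm_def)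
qed

section \<open>Measurability of histories, choices and chosen contexts\<close>

lemma measurable_policy:
  assumes "is_policy K T \<pi>" "t \<in> {1..T}"
    and "U \<in> \<Omega> \<rightarrow>\<^sub>M seed_measure" "h \<in> \<Omega> \<rightarrow>\<^sub>M history_space K (t - 1)" "X \<in> \<Omega> \<rightarrow>\<^sub>M context_space K"
  shows "(\<lambda>\<omega>. \<pi> t (U \<omega>) (h \<omega>) (X \<omega>)) \<in> \<Omega> \<rightarrow>\<^sub>M count_space {1..K}"
proof -
  have 1: "(\<lambda>\<omega>. (U \<omega>, h \<omega>, X \<omega>)) \<in> \<Omega> \<rightarrow>\<^sub>M seed_measure \<Otimes>\<^sub>M history_space K (t - 1) \<Otimes>\<^sub>M context_space K"
    using assms by (intro measurable_Pair)
  have 2: "(\<lambda>(u, h, x). \<pi> t u h x) \<in>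
      seed_measure \<Otimes>\<^sub>M history_space K (t - 1) \<Otimes>\<^sub>M context_space K \<rightarrow>\<^sub>M count_space {1..K}"
    using assms by (auto simp: is_policy_def)
  show ?thesis using measurable_compose[OF 1 2] by simp
qed

lemma measurable_random_context:
  assumes "A \<in> \<Omega> \<rightarrow>\<^sub>M count_space {1..K}" "X \<in> \<Omega> \<rightarrow>\<^sub>M context_space K"
  shows "(\<lambda>\<omega>. X \<omega> (A \<omega>)) \<in> borel_measurable \<Omega>"
proof (rule measurable_compose_countable'[OF _ assms(1)])
  fix a assume "a \<in> {1..K}"
  then show "(\<lambda>\<omega>. X \<omega> a) \<in> borel_measurable \<Omega>"
    using measurable_compose[OF assms(2)[unfolded context_space_def] measurable_component_singleton]
    by auto
qed simp

text \<open>Seed, contexts and noise are arbitrary random elements over a common space, so that one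
  lemma serves both frozen seed and contexts (for predictability) and the full product space (for
  expectations).\<close>

lemma measurable_history:
  assumes pol: "is_policy K T \<pi>" and link [measurable]: "link I \<in> borel_measurable borel"
    and U: "U \<in> \<Omega> \<rightarrow>\<^sub>M seed_measure"
    and X: "\<And>i. i \<in> {1..t} \<Longrightarrow> (\<lambda>\<omega>. X \<omega> i) \<in> \<Omega> \<rightarrow>\<^sub>M context_space K"
    and E: "\<And>i. i \<in> {1..t} \<Longrightarrow> (\<lambda>\<omega>. E \<omega> i) \<in> borel_measurable \<Omega>"
    and "t \<le> T"
  shows "(\<lambda>\<omega>. history I \<pi> (U \<omega>) (X \<omega>) (E \<omega>) t) \<in> \<Omega> \<rightarrow>\<^sub>M history_space K t"
  using X E \<open>t \<le> T\<close>
proof (induction t)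
  case 0
  show ?case by (simp add: history_space_def space_PiM)
next
  case (Suc t)
  have h: "(\<lambda>\<omega>. history I \<pi> (U \<omega>) (X \<omega>) (E \<omega>) t) \<in> \<Omega> \<rightarrow>\<^sub>M history_space K t"
    by (rule Suc.IH) (use Suc.prems in auto)
  have X: "(\<lambda>\<omega>. X \<omega> (Suc t)) \<in> \<Omega> \<rightarrow>\<^sub>M context_space K"
    and E [measurable]: "(\<lambda>\<omega>. E \<omega> (Suc t)) \<in> borel_measurable \<Omega>"
    by (rule Suc.prems(1,2), simp)+
  define A where "A \<omega> = \<pi> (Suc t) (U \<omega>) (history I \<pi> (U \<omega>) (X \<omega>) (E \<omega>) t) (X \<omega> (Suc t))" for \<omega>
  have A: "A \<in> \<Omega> \<rightarrow>\<^sub>M count_space {1..K}"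
    unfolding A_def by (rule measurable_policy[OF pol _ U _ X]) (use Suc.prems(3) h in simp_all)
  have [measurable]: "(\<lambda>\<omega>. X \<omega> (Suc t) (A \<omega>)) \<in> borel_measurable \<Omega>"
    by (rule measurable_random_context[OF A X])
  have "(\<lambda>\<omega>. link I (X \<omega> (Suc t) (A \<omega>) * param I) + E \<omega> (Suc t)) \<in> borel_measurable \<Omega>"
    by measurable
  then have "(\<lambda>\<omega>. (X \<omega> (Suc t), A \<omega>, link I (X \<omega> (Suc t) (A \<omega>) * param I) + E \<omega> (Suc t)))
      \<in> \<Omega> \<rightarrow>\<^sub>M context_space K \<Otimes>\<^sub>M count_space {1..K} \<Otimes>\<^sub>M borel"
    using A X by (intro measurable_Pair)
  then have "(\<lambda>\<omega>. (history I \<pi> (U \<omega>) (X \<omega>) (E \<omega>) t)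
      (Suc t := (X \<omega> (Suc t), A \<omega>, link I (X \<omega> (Suc t) (A \<omega>) * param I) + E \<omega> (Suc t))))
      \<in> \<Omega> \<rightarrow>\<^sub>M history_space K (Suc t)"
    using h unfolding history_space_def by (intro measurable_fun_upd[OF atLeastAtMost_Un_Suc])
  moreover have "history I \<pi> (U \<omega>) (X \<omega>) (E \<omega>) (Suc t) = (history I \<pi> (U \<omega>) (X \<omega>) (E \<omega>) t)
      (Suc t := (X \<omega> (Suc t), A \<omega>, link I (X \<omega> (Suc t) (A \<omega>) * param I) + E \<omega> (Suc t)))" for \<omega>
    by (simp add: A_def Let_def)
  ultimately show ?case by (simp only:)
qed

text \<open>Noise is required only up to round \<open>t - 1\<close>, since the arm is chosen before
  the reward is seen; this is the source of predictability.\<close>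

lemma measurable_chosen_arm:
  assumes pol: "is_policy K T \<pi>" and link: "link I \<in> borel_measurable borel"
    and U: "U \<in> \<Omega> \<rightarrow>\<^sub>M seed_measure"
    and X: "\<And>i. i \<in> {1..t} \<Longrightarrow> (\<lambda>\<omega>. X \<omega> i) \<in> \<Omega> \<rightarrow>\<^sub>M context_space K"
    and E: "\<And>i. i \<in> {1..t - 1} \<Longrightarrow> (\<lambda>\<omega>. E \<omega> i) \<in> borel_measurable \<Omega>"
    and t: "t \<in> {1..T}"
  shows "(\<lambda>\<omega>. chosen_arm I \<pi> (U \<omega>) (X \<omega>) (E \<omega>) t) \<in> \<Omega> \<rightarrow>\<^sub>M count_space {1..K}"
proof -
  have le: "t - 1 \<le> T" and sub: "{1..t - 1} \<subseteq> {1..t}" and tt: "t \<in> {1..t}"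
    using t by auto
  have X': "(\<lambda>\<omega>. X \<omega> i) \<in> \<Omega> \<rightarrow>\<^sub>M context_space K" if "i \<in> {1..t - 1}" for i
    by (rule X) (use sub that in blast)
  have "(\<lambda>\<omega>. history I \<pi> (U \<omega>) (X \<omega>) (E \<omega>) (t - 1)) \<in> \<Omega> \<rightarrow>\<^sub>M history_space K (t - 1)"
    using pol link U X' E le by (rule measurable_history)
  with pol t U show ?thesis
    unfolding chosen_arm_def using X[OF tt] by (rule measurable_policy)
qed

lemma measurable_chosen_context:
  assumes "is_policy K T \<pi>" "link I \<in> borel_measurable borel" "U \<in> \<Omega> \<rightarrow>\<^sub>M seed_measure"
    and "\<And>i. i \<in> {1..t} \<Longrightarrow> (\<lambda>\<omega>. X \<omega> i) \<in> \<Omega> \<rightarrow>\<^sub>M context_space K"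
    and "\<And>i. i \<in> {1..t - 1} \<Longrightarrow> (\<lambda>\<omega>. E \<omega> i) \<in> borel_measurable \<Omega>"
    and "t \<in> {1..T}"
  shows "(\<lambda>\<omega>. X \<omega> t (chosen_arm I \<pi> (U \<omega>) (X \<omega>) (E \<omega>) t)) \<in> borel_measurable \<Omega>"
proof (rule measurable_random_context[where X = "\<lambda>\<omega>. X \<omega> t"])
  show "(\<lambda>\<omega>. chosen_arm I \<pi> (U \<omega>) (X \<omega>) (E \<omega>) t) \<in> \<Omega> \<rightarrow>\<^sub>M count_space {1..K}"
    using assms by (rule measurable_chosen_arm)
  show "(\<lambda>\<omega>. X \<omega> t) \<in> \<Omega> \<rightarrow>\<^sub>M context_space K"
    by (rule assms(4)) (use assms(6) in auto)
qed

text \<open>With seed and contexts fixed, the choice in round \<open>t\<close> is a function of the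
  earlier noise. The case of interest takes for \<open>g\<close> the difference of two links, giving
  the drift.\<close>

lemma predictable_chosen_context:
  assumes "is_policy K T \<pi>" "link I \<in> borel_measurable borel" "u \<in> space seed_measure"
    and x: "\<And>i. i \<in> {1..T} \<Longrightarrow> x i \<in> space (context_space K)" and g: "g \<in> borel_measurable borel"
  shows "predictable T (\<lambda>t \<eta>. g (x t (chosen_arm I \<pi> u x \<eta> t)))"
  unfolding predictable_def
proof (intro ballI conjI allI)
  fix t assume t: "t \<in> {1..T}"
  have "(\<lambda>\<eta>. x t (chosen_arm I \<pi> u x \<eta> t)) \<in> borel_measurable (noise (t - 1))"
    by (rule measurable_chosen_context[where U = "\<lambda>_. u" and X = "\<lambda>_. x" and E = "\<lambda>\<eta>. \<eta>", OF assms(1,2)])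
      (use assms(3) x t measurable_noise_component in auto)
  then show "(\<lambda>\<eta>. g (x t (chosen_arm I \<pi> u x \<eta> t))) \<in> borel_measurable (noise (t - 1))"
    using g by measurable
next
  fix t \<eta>
  have "chosen_arm I \<pi> u x (restrict \<eta> {1..t - 1}) t = chosen_arm I \<pi> u x \<eta> t"
    by (rule chosen_arm_cong) auto
  then show "g (x t (chosen_arm I \<pi> u x (restrict \<eta> {1..t - 1}) t)) = g (x t (chosen_arm I \<pi> u x \<eta> t))"
    by simp
qed

section \<open>Missed rounds\<close>

definition available :: "nat \<Rightarrow> real set \<Rightarrow> (nat \<Rightarrow> real) \<Rightarrow> bool" where
  "available K C y \<longleftrightarrow> (\<exists>a\<in>{1..K}. y a \<in> C)"

text \<open>Two sets are needed: on \<open>C\<close> the bump is at least half as high as its peak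
  bound, while \<open>B\<close> carries all of it. Division by \<open>T\<close> puts the value in
  the unit interval, so that it can serve as the test function of the change of measure.\<close>

definition miss_fraction ::
  "sib_instance \<Rightarrow> nat \<Rightarrow> nat \<Rightarrow> policy \<Rightarrow> real set \<Rightarrow> real set
     \<Rightarrow> (nat \<Rightarrow> real) \<Rightarrow> (nat \<Rightarrow> nat \<Rightarrow> real) \<Rightarrow> (nat \<Rightarrow> real) \<Rightarrow> real" where
  "miss_fraction I K T \<pi> C B u x \<eta> =
     (\<Sum>t=1..T. of_bool (available K C (x t) \<and> x t (chosen_arm I \<pi> u x \<eta> t) \<notin> B)) / T"

definition visits ::
  "sib_instance \<Rightarrow> nat \<Rightarrow> policy \<Rightarrow> real set
     \<Rightarrow> (nat \<Rightarrow> real) \<Rightarrow> (nat \<Rightarrow> nat \<Rightarrow> real) \<Rightarrow> (nat \<Rightarrow> real) \<Rightarrow> real" where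
  "visits I T \<pi> B u x \<eta> = (\<Sum>t=1..T. of_bool (x t (chosen_arm I \<pi> u x \<eta> t) \<in> B))"

definition available_fraction :: "nat \<Rightarrow> nat \<Rightarrow> real set \<Rightarrow> (nat \<Rightarrow> nat \<Rightarrow> real) \<Rightarrow> real" where
  "available_fraction K T C x = (\<Sum>t=1..T. of_bool (available K C (x t))) / T"

lemma miss_fraction_bounds:
  "0 \<le> miss_fraction I K T \<pi> C B u x \<eta>" "miss_fraction I K T \<pi> C B u x \<eta> \<le> 1"
proof -
  let ?m = "\<lambda>t. of_bool (available K C (x t) \<and> x t (chosen_arm I \<pi> u x \<eta> t) \<notin> B) :: real"
  have "(\<Sum>t=1..T. ?m t) \<le> (\<Sum>t=1..T. 1)" by (rule sum_mono) auto
  then show "miss_fraction I K T \<pi> C B u x \<eta> \<le> 1"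
    by (cases "T = 0") (auto simp: miss_fraction_def divide_le_eq)
  show "0 \<le> miss_fraction I K T \<pi> C B u x \<eta>"
    by (auto simp: miss_fraction_def intro!: divide_nonneg_nonneg sum_nonneg)
qed

lemma visits_nonneg: "0 \<le> visits I T \<pi> B u x \<eta>"
  by (simp add: visits_def sum_nonneg)

text \<open>A round in which \<open>C\<close> is available is either missed or a visit to
  \<open>B\<close>.\<close>

lemma available_fraction_le:
  "available_fraction K T C x \<le> miss_fraction I K T \<pi> C B u x \<eta> + visits I T \<pi> B u x \<eta> / T"
  unfolding available_fraction_def miss_fraction_def visits_def
    add_divide_distrib[symmetric] sum.distrib[symmetric]
  by (intro divide_right_mono sum_mono) auto

text \<open>Each round contributes to at most one of the disjoint sets.\<close>

lemma sum_visits_le: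
  assumes "finite J" "disjoint_family_on B J"
  shows "(\<Sum>j\<in>J. visits I T \<pi> (B j) u x \<eta>) \<le> T"
proof -
  have "(\<Sum>j\<in>J. of_bool (z \<in> B j) :: real) \<le> 1" for z
  proof (cases "\<exists>j\<in>J. z \<in> B j")
    case True
    then obtain j where j: "j \<in> J" "z \<in> B j" by blast
    then have "(\<Sum>i\<in>J. of_bool (z \<in> B i) :: real) = (\<Sum>i\<in>J. of_bool (i = j))"
      using assms(2) by (intro sum.cong) (auto simp: disjoint_family_on_def)
    then show ?thesis using assms(1) j by simp
  next
    case False
    then show ?thesis by (simp add: sum.neutral)
  qed
  then have "(\<Sum>t=1..T. \<Sum>j\<in>J. of_bool (x t (chosen_arm I \<pi> u x \<eta> t) \<in> B j)) \<le> (\<Sum>t=1..T. 1::real)"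
    by (rule sum_mono)
  then show ?thesis unfolding visits_def by (subst sum.swap) simp
qed

lemma measurable_available:
  assumes "C \<in> sets borel"
  shows "(\<lambda>y. of_bool (available K C y) :: real) \<in> borel_measurable (context_space K)"
proof -
  have [measurable]: "(\<lambda>y. y a) \<in> borel_measurable (context_space K)" if "a \<in> {1..K}" for a
    unfolding context_space_def by (rule measurable_component_singleton[OF that])
  have [measurable]: "Measurable.pred (context_space K) (\<lambda>y. y a \<in> C)" if "a \<in> {1..K}" for a
    using that assms by measurable
  have "Measurable.pred (context_space K) (available K C)"
    unfolding available_def by (rule pred_intros_finite) auto
  then show ?thesis by measurable
qed

lemma measurable_miss_fraction:
  assumes "is_policy K T \<pi>" "link I \<in> borel_measurable borel" "U \<in> \<Omega> \<rightarrow>\<^sub>M seed_measure"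
    and X: "\<And>i. i \<in> {1..T} \<Longrightarrow> (\<lambda>\<omega>. X \<omega> i) \<in> \<Omega> \<rightarrow>\<^sub>M context_space K"
    and E: "\<And>i. i \<in> {1..T} \<Longrightarrow> (\<lambda>\<omega>. E \<omega> i) \<in> borel_measurable \<Omega>"
    and C: "C \<in> sets borel" and B [measurable]: "B \<in> sets borel"
  shows "(\<lambda>\<omega>. miss_fraction I K T \<pi> C B (U \<omega>) (X \<omega>) (E \<omega>)) \<in> borel_measurable \<Omega>"
proof -
  have "(\<lambda>\<omega>. of_bool (available K C (X \<omega> t) \<and> X \<omega> t (chosen_arm I \<pi> (U \<omega>) (X \<omega>) (E \<omega>) t) \<notin> B) :: real)
     \<in> borel_measurable \<Omega>" if t: "t \<in> {1..T}" for t
  proof -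
    have [measurable]: "(\<lambda>\<omega>. X \<omega> t (chosen_arm I \<pi> (U \<omega>) (X \<omega>) (E \<omega>) t)) \<in> borel_measurable \<Omega>"
      by (rule measurable_chosen_context[OF assms(1-3)]) (use X E t in auto)
    have [measurable]: "(\<lambda>\<omega>. of_bool (available K C (X \<omega> t)) :: real) \<in> borel_measurable \<Omega>"
      by (rule measurable_compose[OF X[OF t] measurable_available[OF C]])
    have "(\<lambda>\<omega>. of_bool (available K C (X \<omega> t)) *
        indicator (- B) (X \<omega> t (chosen_arm I \<pi> (U \<omega>) (X \<omega>) (E \<omega>) t)) :: real) \<in> borel_measurable \<Omega>"
      by measurable
    then show ?thesis by (simp add: indicator_def of_bool_conj if_distrib)
  qed
  then show ?thesis unfolding miss_fraction_def by measurable
qed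

lemma measurable_visits:
  assumes "is_policy K T \<pi>" "link I \<in> borel_measurable borel" "u \<in> space seed_measure"
    and "\<And>i. i \<in> {1..T} \<Longrightarrow> x i \<in> space (context_space K)" and B [measurable]: "B \<in> sets borel"
  shows "visits I T \<pi> B u x \<in> borel_measurable (noise T)"
proof -
  have "(\<lambda>\<eta>. indicator B (x t (chosen_arm I \<pi> u x \<eta> t)) :: real) \<in> borel_measurable (noise T)"
    if "t \<in> {1..T}" for t
    using predictable_measurable[OF predictable_chosen_context[OF assms(1-4)
          borel_measurable_indicator[OF B]] that] that by auto
  then show ?thesis
    unfolding visits_def indicator_def[abs_def] of_bool_def by measurable
qed

text \<open>Available rounds split into misses and visits under \<open>I\<close>; the change of
  measure carries the misses over to \<open>J\<close>. The drift vanishes unless the chosen context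
  lies in \<open>B\<close>, so its squared sum is charged to visits as well. All visits are counted
  under \<open>I\<close>, the instance shared by all alternatives, which allows summing over them
  later.\<close>

lemma available_fraction_le_miss:
  assumes pol: "is_policy K T \<pi>" and I: "link I \<in> borel_measurable borel" "param I = 1"
    and J: "link J \<in> borel_measurable borel" "param J = 1"
    and g: "\<And>z. \<bar>link J z - link I z\<bar> \<le> \<Delta> * of_bool (z \<in> B)"
    and B: "B \<in> sets borel" and C: "C \<in> sets borel"
    and u: "u \<in> space seed_measure" and x: "\<And>i. i \<in> {1..T} \<Longrightarrow> x i \<in> space (context_space K)"
    and l: "l > 0"
  shows "ennreal (available_fraction K T C x)
    \<le> (\<integral>\<^sup>+\<eta>. ennreal (miss_fraction J K T \<pi> C B u x \<eta>) \<partial>noise T) + ennreal (1 / l)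
      + ennreal ((l + 1) / 2 * \<Delta>\<^sup>2 + 1 / T) * (\<integral>\<^sup>+\<eta>. ennreal (visits I T \<pi> B u x \<eta>) \<partial>noise T)"
proof -
  define b where "b t \<eta> = link J (x t (chosen_arm I \<pi> u x \<eta> t)) - link I (x t (chosen_arm I \<pi> u x \<eta> t))"
    for t \<eta>
  have pb: "predictable T b"
    unfolding b_def by (rule predictable_chosen_context[OF pol I(1) u x]) (use I J in auto)
  have arm: "chosen_arm J \<pi> u x (unshift T b \<eta>) t = chosen_arm I \<pi> u x \<eta> t" if "t \<in> {1..T}" for t \<eta>
    by (rule chosen_arm_unshift[OF _ that]) (simp add: b_def I J)
  \<comment> \<open>Contexts are fixed and the arms agree, so the misses of \<open>J\<close> under
    shifted noise are those of \<open>I\<close>.\<close>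
  have miss: "miss_fraction J K T \<pi> C B u x (unshift T b \<eta>) = miss_fraction I K T \<pi> C B u x \<eta>" for \<eta>
    by (simp add: miss_fraction_def arm)
  have V: "(\<Sum>t=1..T. (b t \<eta>)\<^sup>2) \<le> \<Delta>\<^sup>2 * visits I T \<pi> B u x \<eta>" for \<eta>
    unfolding visits_def sum_distrib_left
  proof (rule sum_mono)
    fix t
    show "(b t \<eta>)\<^sup>2 \<le> \<Delta>\<^sup>2 * of_bool (x t (chosen_arm I \<pi> u x \<eta> t) \<in> B)"
      using g[of "x t (chosen_arm I \<pi> u x \<eta> t)"] unfolding b_def
      by (auto simp: abs_le_square_iff[symmetric] split: if_splits)
  qed
  have [measurable]: "miss_fraction L K T \<pi> C B u x \<in> borel_measurable (noise T)"
    if "link L \<in> borel_measurable borel" for L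
    by (rule measurable_miss_fraction[where U = "\<lambda>_. u" and X = "\<lambda>_. x" and E = "\<lambda>\<eta>. \<eta>",
          OF pol that measurable_const[OF u] measurable_const[OF x] measurable_noise_component C B])
  note [measurable] = this[OF I(1)] this[OF J(1)]
  have [measurable]: "visits I T \<pi> B u x \<in> borel_measurable (noise T)"
    by (rule measurable_visits[OF pol I(1) u x B])
  have "ennreal (available_fraction K T C x) = (\<integral>\<^sup>+\<eta>. ennreal (available_fraction K T C x) \<partial>noise T)"
    by (simp add: gauss.P.emeasure_space_1)
  also have "\<dots> \<le> (\<integral>\<^sup>+\<eta>. ennreal (miss_fraction I K T \<pi> C B u x \<eta>)
      + ennreal (1 / T) * ennreal (visits I T \<pi> B u x \<eta>) \<partial>noise T)"
  proof (rule nn_integral_mono)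
    fix \<eta>
    show "ennreal (available_fraction K T C x) \<le> ennreal (miss_fraction I K T \<pi> C B u x \<eta>)
      + ennreal (1 / T) * ennreal (visits I T \<pi> B u x \<eta>)"
      using ennreal_leI[OF available_fraction_le[of K T C x I \<pi> B u \<eta>]]
      by (simp add: ennreal_plus[symmetric] ennreal_mult[symmetric] miss_fraction_bounds visits_nonneg
          del: ennreal_plus)
  qed
  also have "\<dots> = (\<integral>\<^sup>+\<eta>. ennreal (miss_fraction I K T \<pi> C B u x \<eta>) \<partial>noise T)
      + ennreal (1 / T) * (\<integral>\<^sup>+\<eta>. ennreal (visits I T \<pi> B u x \<eta>) \<partial>noise T)"
    by (simp add: nn_integral_add nn_integral_cmult)
  also have "(\<integral>\<^sup>+\<eta>. ennreal (miss_fraction I K T \<pi> C B u x \<eta>) \<partial>noise T)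
      \<le> (\<integral>\<^sup>+\<eta>. ennreal (miss_fraction J K T \<pi> C B u x \<eta>) \<partial>noise T) + ennreal (1 / l)
        + ennreal ((l + 1) / 2) * (\<integral>\<^sup>+\<eta>. ennreal (\<Sum>t=1..T. (b t \<eta>)\<^sup>2) \<partial>noise T)"
    using predictable_shift_comparison[OF pb, of "miss_fraction J K T \<pi> C B u x" l] l
    by (simp add: miss miss_fraction_bounds)
  also have "(\<integral>\<^sup>+\<eta>. ennreal (\<Sum>t=1..T. (b t \<eta>)\<^sup>2) \<partial>noise T)
      \<le> (\<integral>\<^sup>+\<eta>. ennreal (\<Delta>\<^sup>2) * ennreal (visits I T \<pi> B u x \<eta>) \<partial>noise T)"
    by (rule nn_integral_mono) (use V visits_nonneg in \<open>auto simp: ennreal_mult[symmetric] intro!: ennreal_leI\<close>)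
  also have "\<dots> = ennreal (\<Delta>\<^sup>2) * (\<integral>\<^sup>+\<eta>. ennreal (visits I T \<pi> B u x \<eta>) \<partial>noise T)"
    by (rule nn_integral_cmult) measurable
  finally have "ennreal (available_fraction K T C x)
    \<le> (\<integral>\<^sup>+\<eta>. ennreal (miss_fraction J K T \<pi> C B u x \<eta>) \<partial>noise T) + ennreal (1 / l)
      + ennreal ((l + 1) / 2) * (ennreal (\<Delta>\<^sup>2) * (\<integral>\<^sup>+\<eta>. ennreal (visits I T \<pi> B u x \<eta>) \<partial>noise T))
      + ennreal (1 / T) * (\<integral>\<^sup>+\<eta>. ennreal (visits I T \<pi> B u x \<eta>) \<partial>noise T)"
    by (simp add: add_left_mono add_right_mono mult_left_mono)
  moreover have "ennreal ((l + 1) / 2 * \<Delta>\<^sup>2 + 1 / T)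
      = ennreal ((l + 1) / 2) * ennreal (\<Delta>\<^sup>2) + ennreal (1 / T)"
    using l by (simp add: ennreal_mult[symmetric] ennreal_plus[symmetric] del: ennreal_plus)
  ultimately show ?thesis
    by (simp only: distrib_right mult.assoc add.assoc)
qed

section \<open>Averaging over a family of instances\<close>

text \<open>The contexts of one round are \<open>K\<close> independent standard normals, hence
  distributed as \<open>noise K\<close>.\<close>

abbreviation contexts :: "nat \<Rightarrow> nat \<Rightarrow> (nat \<Rightarrow> nat \<Rightarrow> real) measure" where
  "contexts K T \<equiv> PiM {1..T} (\<lambda>_. noise K)"

interpretation ctxs: product_prob_space "\<lambda>_::nat. noise K" "{1..T}" for K T
  by (rule product_prob_spaceI) (rule gauss.P.prob_space_axioms)

lemma prob_space_seed: "prob_space seed_measure"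
  unfolding seed_measure_def
  by (intro prob_space_PiM prob_space_uniform_measure) auto

interpretation seed: prob_space seed_measure
  by (rule prob_space_seed)

lemma sets_noise_context: "sets (noise K) = sets (context_space K)"
  unfolding context_space_def by (rule sets_PiM_cong) auto

lemma measurable_contexts_component:
  "t \<in> {1..T} \<Longrightarrow> (\<lambda>x. x t) \<in> contexts K T \<rightarrow>\<^sub>M context_space K"
  using measurable_component_singleton[of t "{1..T}" "\<lambda>_. noise K"]
  by (simp add: measurable_cong_sets[OF refl sets_noise_context])

lemma contexts_component_space:
  "x \<in> space (contexts K T) \<Longrightarrow> t \<in> {1..T} \<Longrightarrow> x t \<in> space (context_space K)"
  using measurable_space[OF measurable_contexts_component] by blast

lemma bandit_measure_std_normal:
  "ctx_dist I = std_normal_distribution \<Longrightarrow> bandit_measure I K T = seed_measure \<Otimes>\<^sub>M contexts K T \<Otimes>\<^sub>M noise T"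
  by (simp add: bandit_measure_def)

lemma measurable_available_noise:
  "C \<in> sets borel \<Longrightarrow> (\<lambda>y. of_bool (available K C y) :: real) \<in> borel_measurable (noise K)"
  using measurable_available by (simp add: measurable_cong_sets[OF sets_noise_context refl])

text \<open>By independence all arms avoid \<open>C\<close> with probability
  \<open>(1 - P(C)) ^ K\<close>, and \<open>1 - q \<le> exp (- q)\<close>.\<close>

lemma prob_available_ge:
  assumes [measurable]: "C \<in> sets borel" and q: "ennreal q \<le> emeasure std_normal_distribution C" "0 \<le> q"
  shows "ennreal (1 - exp (- (real K * q))) \<le> (\<integral>\<^sup>+y. ennreal (of_bool (available K C y)) \<partial>noise K)"
proof -
  have q1: "q \<le> measure std_normal_distribution C"
    using q by (simp add: gauss.M.emeasure_eq_measure)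
  have "measure std_normal_distribution (- C) = 1 - measure std_normal_distribution C"
    using gauss.M.prob_compl[of C] by (simp add: Compl_eq_Diff_UNIV)
  then have c: "emeasure std_normal_distribution (- C) = ennreal (1 - measure std_normal_distribution C)"
    by (simp add: gauss.M.emeasure_eq_measure)
  let ?N = "{1..K} \<rightarrow>\<^sub>E - C"
  have N: "?N \<in> sets (noise K)" by (rule sets_PiM_I_finite) auto
  have "emeasure (noise K) ?N = (\<Prod>i\<in>{1..K}. emeasure std_normal_distribution (- C))"
    by (rule gauss.emeasure_PiM) auto
  also have "\<dots> = ennreal ((1 - measure std_normal_distribution C) ^ K)"
    by (simp add: c ennreal_power)
  finally have "measure (noise K) ?N = (1 - measure std_normal_distribution C) ^ K"
    using gauss.M.prob_le_1[of C] by (intro measure_eq_emeasure_eq_ennreal) auto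
  also have "\<dots> \<le> exp (- q) ^ K"
    using q1 exp_ge_add_one_self[of "- q"] by (intro power_mono) auto
  also have "\<dots> = exp (- (real K * q))" by (simp add: exp_of_nat_mult[symmetric])
  finally have "1 - exp (- (real K * q)) \<le> measure (noise K) (space (noise K) - ?N)"
    using N gauss.P.prob_compl[of ?N K] by simp
  moreover have "space (noise K) - ?N = {y \<in> space (noise K). available K C y}"
    by (auto simp: available_def space_PiM PiE_iff extensional_def)
  then have "(\<integral>\<^sup>+y. ennreal (of_bool (available K C y)) \<partial>noise K)
      = (\<integral>\<^sup>+y. indicator (space (noise K) - ?N) y \<partial>noise K)"
    by (intro nn_integral_cong) (auto simp: indicator_def)
  then have "(\<integral>\<^sup>+y. ennreal (of_bool (available K C y)) \<partial>noise K) = emeasure (noise K) (space (noise K) - ?N)"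
    using N by simp
  ultimately show ?thesis by (simp add: gauss.P.emeasure_eq_measure)
qed

lemma expected_available_fraction_ge:
  assumes C: "C \<in> sets borel" and "T > 0" "0 \<le> p"
    and p: "ennreal p \<le> (\<integral>\<^sup>+y. ennreal (of_bool (available K C y)) \<partial>noise K)"
  shows "ennreal p \<le> (\<integral>\<^sup>+x. ennreal (available_fraction K T C x) \<partial>contexts K T)"
proof -
  have comp: "(\<lambda>x. x t) \<in> contexts K T \<rightarrow>\<^sub>M noise K" if "t \<in> {1..T}" for t
    by (rule measurable_component_singleton[OF that])
  have m: "(\<lambda>x. ennreal (of_bool (available K C (x t)))) \<in> borel_measurable (contexts K T)"
    if "t \<in> {1..T}" for t
    using measurable_compose[OF comp[OF that] measurable_available_noise[OF C]] by simp
  have "(\<integral>\<^sup>+x. ennreal (of_bool (available K C (x t))) \<partial>contexts K T)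
      = (\<integral>\<^sup>+y. ennreal (of_bool (available K C y)) \<partial>distr (contexts K T) (noise K) (\<lambda>x. x t))"
    if "t \<in> {1..T}" for t
    using measurable_available_noise[OF C] comp[OF that] by (subst nn_integral_distr) auto
  then have ge: "ennreal p \<le> (\<integral>\<^sup>+x. ennreal (of_bool (available K C (x t))) \<partial>contexts K T)"
    if "t \<in> {1..T}" for t
    using p that distr_PiM_component[of "{1..T}" "\<lambda>_. noise K" t] gauss.P.prob_space_axioms by simp
  have "ennreal p = ennreal (1 / real T) * (\<Sum>t=1..T. ennreal p)"
    using \<open>T > 0\<close> \<open>0 \<le> p\<close> by (simp add: ennreal_mult[symmetric] ennreal_of_nat_eq_real_of_nat)
  also have "\<dots> \<le> ennreal (1 / real T) *
      (\<Sum>t=1..T. \<integral>\<^sup>+x. ennreal (of_bool (available K C (x t))) \<partial>contexts K T)"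
    by (intro mult_left_mono sum_mono ge) auto
  also have "\<dots> = (\<integral>\<^sup>+x. ennreal (1 / real T) *
      (\<Sum>t=1..T. ennreal (of_bool (available K C (x t)))) \<partial>contexts K T)"
  proof (subst nn_integral_cmult)
    show "(\<lambda>x. \<Sum>t=1..T. ennreal (of_bool (available K C (x t)))) \<in> borel_measurable (contexts K T)"
      by (rule borel_measurable_sum) (rule m)
    show "ennreal (1 / real T) * (\<Sum>t=1..T. \<integral>\<^sup>+x. ennreal (of_bool (available K C (x t))) \<partial>contexts K T)
        = ennreal (1 / real T) * (\<integral>\<^sup>+x. (\<Sum>t=1..T. ennreal (of_bool (available K C (x t)))) \<partial>contexts K T)"
      using m by (subst nn_integral_sum) auto
  qed
  also have "\<dots> = (\<integral>\<^sup>+x. ennreal (available_fraction K T C x) \<partial>contexts K T)"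
    by (simp add: available_fraction_def sum_nonneg ennreal_mult[symmetric])
  finally show ?thesis .
qed

text \<open>Disjointness of the \<open>B j\<close> bounds the total number of visits under
  \<open>I\<close> by \<open>T\<close>, so the information term carries the factor \<open>T\<close>
  and not \<open>N * T\<close>.\<close>

lemma sum_available_le_sum_miss:
  fixes I :: sib_instance and J :: "nat \<Rightarrow> sib_instance"
  assumes pol: "is_policy K T \<pi>" and I: "link I \<in> borel_measurable borel" "param I = 1"
    and J: "\<And>j. j < N \<Longrightarrow> link (J j) \<in> borel_measurable borel" "\<And>j. j < N \<Longrightarrow> param (J j) = 1"
    and g: "\<And>j z. j < N \<Longrightarrow> \<bar>link (J j) z - link I z\<bar> \<le> \<Delta> * of_bool (z \<in> B j)"
    and B: "\<And>j. j < N \<Longrightarrow> B j \<in> sets borel" "disjoint_family_on B {..<N}"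
    and C: "\<And>j. j < N \<Longrightarrow> C j \<in> sets borel"
    and u: "u \<in> space seed_measure" and x: "x \<in> space (contexts K T)" and l: "l > 0"
  shows "(\<Sum>j<N. ennreal (available_fraction K T (C j) x))
    \<le> (\<Sum>j<N. \<integral>\<^sup>+\<eta>. ennreal (miss_fraction (J j) K T \<pi> (C j) (B j) u x \<eta>) \<partial>noise T)
      + ennreal (N / l + ((l + 1) / 2 * \<Delta>\<^sup>2 + 1 / T) * T)"
proof -
  let ?m = "\<lambda>j. \<integral>\<^sup>+\<eta>. ennreal (miss_fraction (J j) K T \<pi> (C j) (B j) u x \<eta>) \<partial>noise T"
  let ?v = "\<lambda>j. \<integral>\<^sup>+\<eta>. ennreal (visits I T \<pi> (B j) u x \<eta>) \<partial>noise T"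
  let ?c = "(l + 1) / 2 * \<Delta>\<^sup>2 + 1 / T"
  have c0: "0 \<le> ?c" using l by simp
  have x': "x i \<in> space (context_space K)" if "i \<in> {1..T}" for i
    by (rule contexts_component_space[OF x that])
  have "(\<Sum>j<N. ?v j) = (\<integral>\<^sup>+\<eta>. (\<Sum>j<N. ennreal (visits I T \<pi> (B j) u x \<eta>)) \<partial>noise T)"
    by (rule nn_integral_sum[symmetric])
      (use measurable_visits[OF pol I(1) u x'] B in auto)
  also have "\<dots> \<le> (\<integral>\<^sup>+\<eta>. ennreal T \<partial>noise T)"
    using sum_visits_le[OF _ B(2)]
    by (intro nn_integral_mono) (auto simp: visits_nonneg intro!: ennreal_leI)
  also have "\<dots> = ennreal T" by (simp add: gauss.P.emeasure_space_1)
  finally have v: "(\<Sum>j<N. ?v j) \<le> ennreal T" .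
  have "(\<Sum>j<N. ennreal (available_fraction K T (C j) x))
      \<le> (\<Sum>j<N. ?m j + ennreal (1 / l) + ennreal ?c * ?v j)"
    by (rule sum_mono, rule available_fraction_le_miss[OF pol I _ _ _ _ _ u x' l]) (use J g B C in auto)
  also have "\<dots> = (\<Sum>j<N. ?m j) + (\<Sum>j<N. ennreal (1 / l)) + ennreal ?c * (\<Sum>j<N. ?v j)"
    by (simp only: sum.distrib sum_distrib_left)
  also have "\<dots> \<le> (\<Sum>j<N. ?m j) + ennreal (N / l) + ennreal ?c * ennreal T"
    using v l by (intro add_mono mult_left_mono)
      (auto simp: ennreal_of_nat_eq_real_of_nat ennreal_mult[symmetric])
  also have "\<dots> = (\<Sum>j<N. ?m j) + ennreal (N / l + ?c * T)"
    using c0 l by (simp add: ennreal_mult[symmetric] ennreal_plus[symmetric] add.assoc del: ennreal_plus)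
  finally show ?thesis .
qed

lemma measurable_miss_fraction_bandit:
  assumes "is_policy K T \<pi>" "link I \<in> borel_measurable borel" "C \<in> sets borel" "B \<in> sets borel"
  shows "(\<lambda>(u, x, \<eta>). miss_fraction I K T \<pi> C B u x \<eta>)
    \<in> borel_measurable (seed_measure \<Otimes>\<^sub>M contexts K T \<Otimes>\<^sub>M noise T)"
proof -
  let ?M = "seed_measure \<Otimes>\<^sub>M contexts K T \<Otimes>\<^sub>M noise T"
  have X: "(\<lambda>\<omega>. fst (snd \<omega>) i) \<in> ?M \<rightarrow>\<^sub>M context_space K" if "i \<in> {1..T}" for i
    by (rule measurable_compose[OF _ measurable_contexts_component[OF that]]) measurable
  have E: "(\<lambda>\<omega>. snd (snd \<omega>) i) \<in> borel_measurable ?M" if "i \<in> {1..T}" for i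
    by (rule measurable_compose[OF _ measurable_noise_component[OF that]]) measurable
  have "(\<lambda>\<omega>. miss_fraction I K T \<pi> C B (fst \<omega>) (fst (snd \<omega>)) (snd (snd \<omega>))) \<in> borel_measurable ?M"
    by (rule measurable_miss_fraction[where U = fst and X = "\<lambda>\<omega>. fst (snd \<omega>)"
          and E = "\<lambda>\<omega>. snd (snd \<omega>)", OF assms(1,2) measurable_fst X E assms(3,4)])
  then show ?thesis by (simp add: case_prod_beta')
qed

text \<open>The comparison for frozen seed and contexts is integrated over both. Availability
  involves neither policy nor noise, so its lower bound passes through unchanged.\<close>

lemma sum_expected_miss_ge:
  fixes I :: sib_instance and J :: "nat \<Rightarrow> sib_instance"
  assumes pol: "is_policy K T \<pi>" and I: "link I \<in> borel_measurable borel" "param I = 1"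
    and J: "\<And>j. j < N \<Longrightarrow> link (J j) \<in> borel_measurable borel" "\<And>j. j < N \<Longrightarrow> param (J j) = 1"
    and D: "\<And>j. j < N \<Longrightarrow> ctx_dist (J j) = std_normal_distribution"
    and g: "\<And>j z. j < N \<Longrightarrow> \<bar>link (J j) z - link I z\<bar> \<le> \<Delta> * of_bool (z \<in> B j)"
    and B: "\<And>j. j < N \<Longrightarrow> B j \<in> sets borel" "disjoint_family_on B {..<N}"
    and C: "\<And>j. j < N \<Longrightarrow> C j \<in> sets borel"
    and p: "\<And>j. j < N \<Longrightarrow> ennreal p \<le> (\<integral>\<^sup>+y. ennreal (of_bool (available K (C j) y)) \<partial>noise K)" "0 \<le> p"
    and l: "l > 0" and T: "T > 0"
  shows "ennreal (N * p)
    \<le> (\<Sum>j<N. \<integral>\<^sup>+(u, x, \<eta>). ennreal (miss_fraction (J j) K T \<pi> (C j) (B j) u x \<eta>) \<partial>bandit_measure (J j) K T)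
      + ennreal (N / l + ((l + 1) / 2 * \<Delta>\<^sup>2 + 1 / T) * T)"
proof -
  let ?r = "N / l + ((l + 1) / 2 * \<Delta>\<^sup>2 + 1 / T) * T"
  let ?A = "\<lambda>x. \<Sum>j<N. ennreal (available_fraction K T (C j) x)"
  define m where "m j u x = (\<integral>\<^sup>+\<eta>. ennreal (miss_fraction (J j) K T \<pi> (C j) (B j) u x \<eta>) \<partial>noise T)" for j u x
  have mm: "(\<lambda>(u, x, \<eta>). ennreal (miss_fraction (J j) K T \<pi> (C j) (B j) u x \<eta>))
      \<in> borel_measurable (seed_measure \<Otimes>\<^sub>M contexts K T \<Otimes>\<^sub>M noise T)" if "j < N" for j
    using measurable_miss_fraction_bandit[OF pol J(1)[OF that] C[OF that] B(1)[OF that]]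
    by (simp add: case_prod_beta')
  have mx: "(\<lambda>(x, \<eta>). ennreal (miss_fraction (J j) K T \<pi> (C j) (B j) u x \<eta>))
      \<in> borel_measurable (contexts K T \<Otimes>\<^sub>M noise T)" if "j < N" "u \<in> space seed_measure" for j u
    using measurable_compose[OF measurable_Pair1'[OF that(2)] mm[OF that(1)]] by simp
  have m1: "m j u \<in> borel_measurable (contexts K T)" if "j < N" "u \<in> space seed_measure" for j u
    unfolding m_def[abs_def]
    by (rule gauss.P.borel_measurable_nn_integral) (rule mx[OF that])
  have avail [measurable]: "(\<lambda>x. ennreal (available_fraction K T (C j) x)) \<in> borel_measurable (contexts K T)"
    if "j < N" for j
  proof -
    have "(\<lambda>x. of_bool (available K (C j) (x t)) :: real) \<in> borel_measurable (contexts K T)"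
      if "t \<in> {1..T}" for t
      by (rule measurable_compose[OF measurable_contexts_component[OF that] measurable_available])
        (rule C[OF \<open>j < N\<close>])
    then show ?thesis unfolding available_fraction_def by measurable
  qed
  \<comment> \<open>Tonelli: noise is integrated first because the comparison is made there; the
    expectation under the bandit measure is one integral over the product.\<close>
  have iter: "(\<integral>\<^sup>+u. \<integral>\<^sup>+x. m j u x \<partial>contexts K T \<partial>seed_measure)
      = (\<integral>\<^sup>+(u, x, \<eta>). ennreal (miss_fraction (J j) K T \<pi> (C j) (B j) u x \<eta>) \<partial>bandit_measure (J j) K T)"
    (is "_ = ?E j") and im: "(\<lambda>u. \<integral>\<^sup>+x. m j u x \<partial>contexts K T) \<in> borel_measurable seed_measure"
    if j: "j < N" for j
  proof -
    interpret xe: prob_space "contexts K T \<Otimes>\<^sub>M noise T"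
      by (rule prob_space_pair[OF ctxs.P.prob_space_axioms gauss.P.prob_space_axioms])
    have fst: "(\<integral>\<^sup>+x. m j u x \<partial>contexts K T)
        = (\<integral>\<^sup>+(x, \<eta>). ennreal (miss_fraction (J j) K T \<pi> (C j) (B j) u x \<eta>) \<partial>(contexts K T \<Otimes>\<^sub>M noise T))"
      if "u \<in> space seed_measure" for u
      unfolding m_def using gauss.P.nn_integral_fst[OF mx[OF j that]] by simp
    have f: "(\<lambda>u. \<integral>\<^sup>+(x, \<eta>). ennreal (miss_fraction (J j) K T \<pi> (C j) (B j) u x \<eta>)
          \<partial>(contexts K T \<Otimes>\<^sub>M noise T)) \<in> borel_measurable seed_measure"
      using xe.borel_measurable_nn_integral_fst[OF mm[OF j]] by simp
    then show "(\<lambda>u. \<integral>\<^sup>+x. m j u x \<partial>contexts K T) \<in> borel_measurable seed_measure"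
      by (simp add: fst cong: measurable_cong)
    have "(\<integral>\<^sup>+u. \<integral>\<^sup>+x. m j u x \<partial>contexts K T \<partial>seed_measure)
      = (\<integral>\<^sup>+u. \<integral>\<^sup>+(x, \<eta>). ennreal (miss_fraction (J j) K T \<pi> (C j) (B j) u x \<eta>)
          \<partial>(contexts K T \<Otimes>\<^sub>M noise T) \<partial>seed_measure)"
      by (rule nn_integral_cong) (rule fst)
    then show "(\<integral>\<^sup>+u. \<integral>\<^sup>+x. m j u x \<partial>contexts K T \<partial>seed_measure) = ?E j"
      using xe.nn_integral_fst[OF mm[OF j]] by (simp add: bandit_measure_std_normal D[OF j])
  qed
  have "ennreal (N * p) = (\<Sum>j<N. ennreal p)"
    using p(2) by (simp add: ennreal_mult ennreal_of_nat_eq_real_of_nat)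
  also have "\<dots> \<le> (\<Sum>j<N. \<integral>\<^sup>+x. ennreal (available_fraction K T (C j) x) \<partial>contexts K T)"
    by (intro sum_mono expected_available_fraction_ge) (use C T p in auto)
  also have "\<dots> = (\<integral>\<^sup>+x. ?A x \<partial>contexts K T)"
    using avail by (intro nn_integral_sum[symmetric]) auto
  also have "\<dots> = (\<integral>\<^sup>+u. \<integral>\<^sup>+x. ?A x \<partial>contexts K T \<partial>seed_measure)"
    by (simp add: seed.emeasure_space_1)
  also have "\<dots> \<le> (\<integral>\<^sup>+u. \<integral>\<^sup>+x. (\<Sum>j<N. m j u x) + ennreal ?r \<partial>contexts K T \<partial>seed_measure)"
    unfolding m_def
    by (intro nn_integral_mono sum_available_le_sum_miss[OF pol I J g B C _ _ l])
  also have "\<dots> = (\<integral>\<^sup>+u. (\<Sum>j<N. \<integral>\<^sup>+x. m j u x \<partial>contexts K T) + ennreal ?r \<partial>seed_measure)"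
  proof (rule nn_integral_cong)
    fix u assume u: "u \<in> space seed_measure"
    have "(\<integral>\<^sup>+x. (\<Sum>j<N. m j u x) + ennreal ?r \<partial>contexts K T)
        = (\<integral>\<^sup>+x. (\<Sum>j<N. m j u x) \<partial>contexts K T) + (\<integral>\<^sup>+x. ennreal ?r \<partial>contexts K T)"
      using m1[OF _ u] by (intro nn_integral_add) auto
    also have "(\<integral>\<^sup>+x. (\<Sum>j<N. m j u x) \<partial>contexts K T) = (\<Sum>j<N. \<integral>\<^sup>+x. m j u x \<partial>contexts K T)"
      using m1[OF _ u] by (intro nn_integral_sum) auto
    finally show "(\<integral>\<^sup>+x. (\<Sum>j<N. m j u x) + ennreal ?r \<partial>contexts K T)
        = (\<Sum>j<N. \<integral>\<^sup>+x. m j u x \<partial>contexts K T) + ennreal ?r"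
      by (simp add: ctxs.P.emeasure_space_1)
  qed
  also have "\<dots> = (\<integral>\<^sup>+u. (\<Sum>j<N. \<integral>\<^sup>+x. m j u x \<partial>contexts K T) \<partial>seed_measure) + (\<integral>\<^sup>+u. ennreal ?r \<partial>seed_measure)"
    using im by (intro nn_integral_add) auto
  also have "(\<integral>\<^sup>+u. (\<Sum>j<N. \<integral>\<^sup>+x. m j u x \<partial>contexts K T) \<partial>seed_measure) = (\<Sum>j<N. ?E j)"
    using im iter by (subst nn_integral_sum) auto
  finally show ?thesis by (simp add: seed.emeasure_space_1)
qed

section \<open>The link functions\<close>

text \<open>The square of the positive part: a cutoff that is still continuously
  differentiable.\<close>

definition sqpos :: "real \<Rightarrow> real" where
  "sqpos y = (max 0 y)\<^sup>2"

lemma DERIV_sqpos: "(sqpos has_real_derivative 2 * max 0 y) (at y)"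
proof -
  consider "y > 0" | "y < 0" | "y = 0" by linarith
  then show ?thesis
  proof cases
    case 1
    have "((\<lambda>y. y\<^sup>2) has_real_derivative 2 * max 0 y) (at y)"
      using 1 by (auto intro!: derivative_eq_intros)
    then show ?thesis
      by (rule has_field_derivative_transform_within_open[where S = "{0<..}"])
        (use 1 in \<open>auto simp: sqpos_def\<close>)
  next
    case 2
    have "((\<lambda>y. 0) has_real_derivative 2 * max 0 y) (at y)"
      using 2 by (auto intro!: derivative_eq_intros)
    then show ?thesis
      by (rule has_field_derivative_transform_within_open[where S = "{..<0}"])
        (use 2 in \<open>auto simp: sqpos_def\<close>)
  next
    case 3
    \<comment> \<open>At the gluing point the difference quotient equals
      \<open>max 0 h\<close>.\<close>
    have "(\<lambda>h. (sqpos (0 + h) - sqpos 0) / h) \<midarrow>0\<rightarrow> 0"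
    proof (rule Lim_null_comparison)
      have "norm ((sqpos (0 + h) - sqpos 0) / h) \<le> \<bar>h\<bar>" for h
        by (cases "h > 0") (auto simp: sqpos_def power2_eq_square)
      then show "\<forall>\<^sub>F h in at 0. norm ((sqpos (0 + h) - sqpos 0) / h) \<le> \<bar>h\<bar>"
        by simp
      show "((\<lambda>h::real. \<bar>h\<bar>) \<longlongrightarrow> 0) (at 0)"
        by (rule tendsto_rabs_zero) simp
    qed
    then show ?thesis using 3 by (simp add: DERIV_def)
  qed
qed

lemma sqpos_nonneg: "0 \<le> sqpos y"
  by (simp add: sqpos_def)

lemma sqpos_le_one: "y \<le> 1 \<Longrightarrow> sqpos y \<le> 1"
  by (auto simp: sqpos_def power_le_one)

lemma sqpos_eq_0: "y \<le> 0 \<Longrightarrow> sqpos y = 0"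
  by (simp add: sqpos_def)

lemma continuous_sqpos [continuous_intros]:
  "continuous_on S f \<Longrightarrow> continuous_on S (\<lambda>x. sqpos (f x))"
  unfolding sqpos_def by (intro continuous_intros)

text \<open>The ramp: 0 up to -1, then \<open>(1 - z^2)^2 / 2\<close> up to 0, then 1/2.\<close>

definition plateau :: "real \<Rightarrow> real" where
  "plateau z = sqpos (1 - sqpos (- z)) / 2"

definition plateau' :: "real \<Rightarrow> real" where
  "plateau' z = 2 * max 0 (- z) * max 0 (1 - sqpos (- z))"

text \<open>The affine coordinate that maps the interval from \<open>j / N\<close> to
  \<open>(j + 1) / N\<close> onto that from -1 to 1.\<close>

definition bin_coord :: "nat \<Rightarrow> nat \<Rightarrow> real \<Rightarrow> real" where
  "bin_coord N j z = 2 * real N * z - (2 * real j + 1)"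

definition bin :: "nat \<Rightarrow> nat \<Rightarrow> real set" where
  "bin N j = {z. \<bar>bin_coord N j z\<bar> < 1}"

definition core :: "nat \<Rightarrow> nat \<Rightarrow> real set" where
  "core N j = {z. \<bar>bin_coord N j z\<bar> \<le> 1 / 2}"

text \<open>The profile \<open>(1 - s^2)^2\<close> in the coordinate \<open>s\<close> of the bin.
  The height \<open>1 / (8 * N)\<close> compensates the slope \<open>2 * N\<close> of the
  coordinate, so the derivative is bounded by 1 uniformly in \<open>N\<close>.\<close>

definition bump :: "nat \<Rightarrow> nat \<Rightarrow> real \<Rightarrow> real" where
  "bump N j z = sqpos (1 - (bin_coord N j z)\<^sup>2) / (8 * real N)"

definition bump' :: "nat \<Rightarrow> nat \<Rightarrow> real \<Rightarrow> real" where
  "bump' N j z = - bin_coord N j z * max 0 (1 - (bin_coord N j z)\<^sup>2)"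

lemma DERIV_plateau: "(plateau has_real_derivative plateau' z) (at z)"
  unfolding plateau_def[abs_def] plateau'_def
  by (rule derivative_eq_intros DERIV_chain2[OF DERIV_sqpos] refl | simp)+

lemma DERIV_bump:
  assumes "N > 0"
  shows "(bump N j has_real_derivative bump' N j z) (at z)"
  unfolding bump_def[abs_def] bump'_def bin_coord_def using assms
  by (auto intro!: derivative_eq_intros DERIV_chain2[OF DERIV_sqpos] simp: field_simps)

lemma continuous_plateau': "continuous_on S plateau'"
  unfolding plateau'_def[abs_def] by (intro continuous_intros)

lemma continuous_bump': "continuous_on S (bump' N j)"
  unfolding bump'_def[abs_def] bin_coord_def by (intro continuous_intros)

lemma plateau_bounds: "0 \<le> plateau z" "plateau z \<le> 1 / 2"
  using sqpos_le_one[of "1 - sqpos (- z)"] sqpos_nonneg by (auto simp: plateau_def)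

lemma plateau_eq_half: "0 \<le> z \<Longrightarrow> plateau z = 1 / 2"
  by (simp add: plateau_def sqpos_eq_0) (simp add: sqpos_def)

lemma plateau'_bounds: "0 \<le> plateau' z" "plateau' z \<le> 2"
proof -
  show "0 \<le> plateau' z" by (simp add: plateau'_def)
  show "plateau' z \<le> 2"
  proof (cases "z \<ge> -1")
    case True
    then have "max 0 (- z) * max 0 (1 - sqpos (- z)) \<le> 1 * 1"
      using sqpos_nonneg[of "- z"] by (intro mult_mono) auto
    then show ?thesis by (simp add: plateau'_def)
  next
    case False
    then have "sqpos (- z) \<ge> 1" using power_mono[of 1 "- z" 2] by (simp add: sqpos_def)
    then show ?thesis by (simp add: plateau'_def)
  qed
qed

lemma bump_nonneg: "0 \<le> bump N j z"
  by (simp add: bump_def sqpos_nonneg)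

lemma bump_le: "bump N j z \<le> 1 / (8 * real N) * of_bool (z \<in> bin N j)"
proof (cases "z \<in> bin N j")
  case True
  then show ?thesis
    using sqpos_le_one[of "1 - (bin_coord N j z)\<^sup>2"] by (simp add: bump_def divide_right_mono)
next
  case False
  then have "1\<^sup>2 \<le> \<bar>bin_coord N j z\<bar>\<^sup>2" by (intro power_mono) (auto simp: bin_def)
  then show ?thesis using False by (simp add: bump_def sqpos_eq_0)
qed

text \<open>On the middle half of the bin \<open>s^2 \<le> 1/4\<close>, and
  \<open>(3/4)^2 = 9/16\<close> exceeds 1/2.\<close>

lemma bump_core:
  assumes "z \<in> core N j"
  shows "1 / (16 * real N) \<le> bump N j z"
proof -
  have "\<bar>bin_coord N j z\<bar>\<^sup>2 \<le> (1 / 2)\<^sup>2"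
    using assms by (intro power_mono) (auto simp: core_def)
  then have "3 / 4 \<le> 1 - (bin_coord N j z)\<^sup>2" by (simp add: power2_eq_square)
  then have "(3 / 4)\<^sup>2 \<le> (max 0 (1 - (bin_coord N j z)\<^sup>2))\<^sup>2"
    by (intro power_mono) auto
  then have "1 / 2 \<le> sqpos (1 - (bin_coord N j z)\<^sup>2)"
    by (simp add: sqpos_def power2_eq_square)
  then have "1 / 2 / (8 * real N) \<le> bump N j z"
    unfolding bump_def by (rule divide_right_mono) simp
  then show ?thesis by simp
qed

text \<open>The indicator, rather than the constant 1, is what makes the effect of the bump on
  \<open>mu_star\<close> as small as the mass of the bin.\<close>

lemma bump'_bound: "\<bar>bump' N j z\<bar> \<le> indicator (bin N j) z"
proof (cases "z \<in> bin N j")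
  case True
  then have "\<bar>bin_coord N j z\<bar> * max 0 (1 - (bin_coord N j z)\<^sup>2) \<le> 1 * 1"
    by (intro mult_mono) (auto simp: bin_def)
  then show ?thesis using True by (simp add: bump'_def abs_mult)
next
  case False
  then have "1\<^sup>2 \<le> \<bar>bin_coord N j z\<bar>\<^sup>2" by (intro power_mono) (auto simp: bin_def)
  then show ?thesis using False by (simp add: bump'_def)
qed

lemma bin_interval:
  assumes "N > 0"
  shows "bin N j = {real j / N <..< (real j + 1) / N}"
  using assms by (auto simp: bin_def bin_coord_def abs_less_iff field_simps)

lemma core_interval:
  assumes "N > 0"
  shows "core N j = {(real j + 1 / 4) / N .. (real j + 3 / 4) / N}"
  unfolding core_def bin_coord_def abs_le_iff using assms by (auto simp: field_simps)

lemma core_subset: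
  assumes "j < N"
  shows "core N j \<subseteq> {0..1}"
proof
  fix z assume "z \<in> core N j"
  then have z: "(real j + 1 / 4) / N \<le> z" "z \<le> (real j + 3 / 4) / N"
    using core_interval[of N j] assms by auto
  have "0 \<le> (real j + 1 / 4) / N" by simp
  then have "0 \<le> z" using z(1) by (rule order_trans)
  moreover have "(real j + 3 / 4) / N \<le> 1" using assms by (simp add: divide_le_eq)
  with z(2) have "z \<le> 1" by (rule order_trans)
  ultimately show "z \<in> {0..1}" by simp
qed

text \<open>A common point would put \<open>2 * N * z\<close> within distance 1 of two odd integers
  \<open>2 * i + 1\<close> and \<open>2 * j + 1\<close>.\<close>

lemma disjoint_bins:
  assumes "N > 0"
  shows "disjoint_family (bin N)"
proof -
  have "i = j" if "z \<in> bin N i" "z \<in> bin N j" for i j z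
  proof -
    have "\<bar>2 * real i - 2 * real j\<bar> < 2"
      using that by (auto simp: bin_def bin_coord_def)
    then show "i = j" by linarith
  qed
  then show ?thesis by (auto simp: disjoint_family_on_def)
qed

section \<open>The hard instances\<close>

definition bump_instance :: "nat \<Rightarrow> nat \<Rightarrow> sib_instance" where
  "bump_instance N j =
     \<lparr>param = 1, link = (\<lambda>z. plateau z + bump N j z), ctx_dist = density lborel std_normal_density\<rparr>"

lemma bump_instance_simps [simp]:
  "param (bump_instance N j) = 1"
  "link (bump_instance N j) z = plateau z + bump N j z"
  "ctx_dist (bump_instance N j) = density lborel std_normal_density"
  by (simp_all add: bump_instance_def)

lemma DERIV_link_bump_instance:
  "N > 0 \<Longrightarrow> (link (bump_instance N j) has_real_derivative plateau' z + bump' N j z) (at z)"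
  unfolding bump_instance_def by (auto intro!: DERIV_add DERIV_plateau DERIV_bump)

lemma deriv_link_bump_instance:
  "N > 0 \<Longrightarrow> deriv (link (bump_instance N j)) = (\<lambda>z. plateau' z + bump' N j z)"
  using DERIV_imp_deriv[OF DERIV_link_bump_instance] by blast

text \<open>The bounds hold on the whole line, whatever the window: values are at most 1/2 + 1/8 and
  slopes at most 2 + 1 = 3.\<close>

lemma valid_link_bump_instance:
  assumes "N > 0" "L \<ge> 1" "L' \<ge> 3"
  shows "valid_link W L L' (link (bump_instance N j))"
proof -
  have "link (bump_instance N j) C1_differentiable_on UNIV"
    unfolding C1_differentiable_on_def
    using DERIV_link_bump_instance[OF assms(1)]
    by (intro exI[of _ "\<lambda>z. plateau' z + bump' N j z"] conjI continuous_intros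
        continuous_plateau' continuous_bump') (simp add: has_real_derivative_iff_has_vector_derivative)
  moreover have "\<bar>link (bump_instance N j) z\<bar> \<le> L" for z
  proof -
    have "1 / (8 * real N) \<le> 1 / 8" using assms(1) by (simp add: field_simps)
    then have "bump N j z \<le> 1 / 8"
      using bump_le[of N j z] by (auto split: if_splits simp: of_bool_def)
    then show ?thesis
      using plateau_bounds[of z] bump_nonneg[of N j z] assms by simp
  qed
  moreover have "\<bar>deriv (link (bump_instance N j)) z\<bar> \<le> L'" for z
  proof -
    have "\<bar>bump' N j z\<bar> \<le> 1"
      using bump'_bound[of N j z] by (rule order_trans) (simp add: indicator_def)
    then show ?thesis
      using plateau'_bounds[of z] assms(3) unfolding deriv_link_bump_instance[OF assms(1)]
      by linarith
  qed
  ultimately show ?thesis by (simp add: valid_link_def)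
qed

section \<open>The standard normal context distribution\<close>

lemma std_normal_density_le_0: "std_normal_density x \<le> std_normal_density 0"
  by (simp add: std_normal_density_def divide_right_mono)

lemma std_normal_density_ge_1: "\<bar>x\<bar> \<le> 1 \<Longrightarrow> std_normal_density 1 \<le> std_normal_density x"
  by (simp add: std_normal_density_def divide_right_mono abs_square_le_1)

lemma std_normal_density_1_ge: "std_normal_density 0 / 2 \<le> std_normal_density 1"
proof -
  have "1 / 2 \<le> exp (- 1 / 2 :: real)" using exp_ge_add_one_self[of "- 1 / 2"] by simp
  then show ?thesis by (simp add: std_normal_density_def field_simps)
qed

text \<open>Completing the square gives the moment generating function exactly, so the bound is
  attained.\<close>

lemma one_sub_gaussian_std_normal: "one_sub_gaussian std_normal_distribution"
  unfolding one_sub_gaussian_def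
proof
  fix s :: real
  have eq: "std_normal_density x * exp (s * x) = exp (s\<^sup>2 / 2) * normal_density s 1 x" for x
    by (simp add: normal_density_def exp_add[symmetric] power2_eq_square field_simps)
  have i: "integrable lborel (\<lambda>x. exp (s\<^sup>2 / 2) * normal_density s 1 x)"
    by (intro integrable_mult_right integrable_normal_density) simp
  have "integrable std_normal_distribution (\<lambda>x. exp (s * x))"
    using i by (subst integrable_density) (auto simp: eq)
  moreover have "(\<integral>x. exp (s * x) \<partial>std_normal_distribution) = exp (s\<^sup>2 / 2)"
    by (subst integral_density) (auto simp: eq)
  ultimately show "integrable std_normal_distribution (\<lambda>x. exp (s * x)) \<and> (\<integral>x. exp (s * x) \<partial>std_normal_distribution) \<le> exp (s\<^sup>2 / 2)"
    by simp
qed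

lemma DERIV_std_normal_density:
  "(std_normal_density has_real_derivative - x * std_normal_density x) (at x)"
  unfolding std_normal_density_def[abs_def]
  by (auto intro!: derivative_eq_intros simp: field_simps)

lemma score_std_normal: "score std_normal_density x = x"
proof -
  have "((\<lambda>z. ln (std_normal_density z)) has_real_derivative - x) (at x)"
    by (rule derivative_eq_intros DERIV_std_normal_density refl | simp add: normal_density_pos less_imp_neq[OF normal_density_pos, symmetric])+
  then show ?thesis by (simp add: score_def DERIV_imp_deriv)
qed

text \<open>The score is the identity, so its second moment is the Gaussian variance 1.\<close>

lemma valid_ctx_dist_std_normal: "valid_ctx_dist 1 std_normal_distribution"
proof -
  have i: "has_bochner_integral lborel (\<lambda>x. std_normal_density x * x\<^sup>2) 1"
    using std_normal_moment_even[of 1] by (simp add: fact_numeral)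
  have "integrable std_normal_distribution (\<lambda>x. (score std_normal_density x)\<^sup>2)"
    using i by (subst integrable_density) (auto simp: score_std_normal has_bochner_integral_iff)
  moreover have "(\<integral>x. (score std_normal_density x)\<^sup>2 \<partial>std_normal_distribution) = 1"
    using i by (subst integral_density) (auto simp: score_std_normal has_bochner_integral_iff)
  moreover have "std_normal_density C1_differentiable_on UNIV"
    unfolding C1_differentiable_on_def
    using DERIV_std_normal_density
    by (intro exI[of _ "\<lambda>x. - x * std_normal_density x"] conjI)
      (auto simp: has_real_derivative_iff_has_vector_derivative std_normal_density_def
        intro!: continuous_intros)
  moreover have "\<forall>x. 0 < std_normal_density x" by (simp add: normal_density_pos)
  ultimately show ?thesis
    using prob_space_std_normal one_sub_gaussian_std_normal unfolding valid_ctx_dist_def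
    by (metis order_refl)
qed

text \<open>The constants of the theorem are fixed before \<open>\<rho>\<close>, so a bound uniform
  in \<open>\<rho>\<close> is required: the derivative of \<open>\<rho>\<close> is nonnegative with
  integral 1, and the density is largest at 0.\<close>

lemma c1_le:
  assumes "is_transition \<rho>"
  shows "c\<^sub>1 \<rho> \<le> std_normal_density 0"
proof -
  have d: "(deriv ^^ n) \<rho> differentiable (at x)" for n x
    using assms by (auto simp: is_transition_def)
  have D: "(\<rho> has_real_derivative deriv \<rho> x) (at x)" for x
    using d[of 0 x] by (simp add: DERIV_deriv_iff_real_differentiable)
  have C: "isCont (deriv \<rho>) x" for x
    using d[of "Suc 0" x] by (simp add: differentiable_imp_continuous_within)
  have Ccont: "continuous_on S (deriv \<rho>)" for S
    using C by (simp add: continuous_at_imp_continuous_on)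
  \<comment> \<open>Strict monotonicity is given only on the open interval from -1 to 0; elsewhere
    one of the two values is an extreme of the range.\<close>
  have "mono \<rho>"
  proof (rule monoI)
    fix x y :: real assume "x \<le> y"
    have 01: "0 \<le> \<rho> z" "\<rho> z \<le> 1" for z
      using assms range_subsetD[of \<rho> "{0..1}" z] by (auto simp: is_transition_def)
    consider "x \<le> -1" | "y \<ge> 0" | "x = y" | "x \<in> {-1<..<0}" "y \<in> {-1<..<0}" "x < y"
      using \<open>x \<le> y\<close> by fastforce
    then show "\<rho> x \<le> \<rho> y"
    proof cases
      case 1
      then show ?thesis using 01 assms by (auto simp: is_transition_def)
    next
      case 2
      then show ?thesis using 01 assms by (auto simp: is_transition_def)
    next
      case 4
      then have "\<rho> x < \<rho> y"
        using assms strict_mono_onD[of "{-1<..<0}" \<rho> x y] by (simp add: is_transition_def)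
      then show ?thesis by simp
    qed simp
  qed
  then have "mono_on UNIV \<rho>" by (simp add: mono_on_def monoD)
  then have pos: "deriv \<rho> x \<ge> 0" for x
    using mono_on_imp_deriv_nonneg[of UNIV \<rho> "deriv \<rho> x" x] D by simp
  have cs: "continuous_on S std_normal_density" for S
    unfolding std_normal_density_def by (intro continuous_intros) auto
  have "c\<^sub>1 \<rho> \<le> (LBINT x:{-1..0}. deriv \<rho> x * std_normal_density 0)"
    unfolding c\<^sub>1_def
    by (intro set_integral_mono borel_integrable_atLeastAtMost' continuous_intros Ccont cs
        mult_left_mono pos std_normal_density_le_0)
  also have "\<dots> = (\<integral>x. (deriv \<rho> x * std_normal_density 0) * indicator {-1..0} x \<partial>lborel)"
    unfolding set_lebesgue_integral_def by (rule Bochner_Integration.integral_cong) auto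
  also have "\<dots> = \<rho> 0 * std_normal_density 0 - \<rho> (-1) * std_normal_density 0"
    by (rule integral_FTC_Icc_real) (auto intro!: DERIV_cmult_right D C continuous_intros)
  also have "\<dots> = std_normal_density 0"
    using assms by (simp add: is_transition_def)
  finally show ?thesis .
qed

text \<open>The core has width \<open>1 / (2 * N)\<close> and lies between 0 and 1, where the
  density is at least \<open>p_min\<close>.\<close>

lemma emeasure_core_ge:
  assumes "j < N"
  shows "ennreal (std_normal_density 1 / (2 * real N)) \<le> emeasure std_normal_distribution (core N j)"
proof -
  have N: "N > 0" using assms by simp
  have [measurable]: "core N j \<in> sets borel" by (simp add: core_interval[OF N])
  have "emeasure lborel (core N j) = ennreal (1 / (2 * real N))"
    using N by (simp add: core_interval divide_right_mono diff_divide_distrib[symmetric])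
  then have "ennreal (std_normal_density 1 / (2 * real N)) = ennreal (std_normal_density 1) * emeasure lborel (core N j)"
    by (simp add: ennreal_mult[symmetric])
  also have "\<dots> = (\<integral>\<^sup>+x. ennreal (std_normal_density 1) * indicator (core N j) x \<partial>lborel)"
    by (simp add: nn_integral_cmult_indicator)
  also have "\<dots> \<le> (\<integral>\<^sup>+x. ennreal (std_normal_density x) * indicator (core N j) x \<partial>lborel)"
    using core_subset[OF assms] by (intro nn_integral_mono)
      (auto simp: indicator_def intro!: ennreal_leI std_normal_density_ge_1)
  also have "\<dots> = emeasure std_normal_distribution (core N j)"
    by (subst emeasure_density) auto
  finally show ?thesis .
qed

lemma measure_bin_le:
  assumes "N > 0"
  shows "measure std_normal_distribution (bin N j) \<le> std_normal_density 0 / N"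
proof -
  have [measurable]: "bin N j \<in> sets borel" by (simp add: bin_interval[OF assms])
  have "emeasure std_normal_distribution (bin N j) = (\<integral>\<^sup>+x. ennreal (std_normal_density x) * indicator (bin N j) x \<partial>lborel)"
    by (subst emeasure_density) auto
  also have "\<dots> \<le> (\<integral>\<^sup>+x. ennreal (std_normal_density 0) * indicator (bin N j) x \<partial>lborel)"
    by (intro nn_integral_mono) (auto simp: indicator_def intro!: ennreal_leI std_normal_density_le_0)
  also have "\<dots> = ennreal (std_normal_density 0) * emeasure lborel (bin N j)"
    by (simp add: nn_integral_cmult_indicator)
  also have "emeasure lborel (bin N j) = ennreal (1 / N)"
    using assms by (simp add: bin_interval divide_right_mono diff_divide_distrib[symmetric])
  finally have "emeasure std_normal_distribution (bin N j) \<le> ennreal (std_normal_density 0 / N)"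
    by (simp add: ennreal_mult[symmetric])
  then show ?thesis
    by (simp add: measure_def enn2real_leI)
qed

lemma integrable_std_normal_bounded:
  fixes f :: "real \<Rightarrow> real"
  assumes "f \<in> borel_measurable borel" "\<And>x. \<bar>f x\<bar> \<le> B"
  shows "integrable std_normal_distribution f"
  using assms
  by (intro finite_measure.integrable_const_bound[OF prob_space.finite_measure[OF prob_space_std_normal]])
    auto

lemma integrable_deriv_link:
  assumes "N > 0"
  shows "integrable std_normal_distribution (deriv (link (bump_instance N j)))"
proof -
  have [measurable]: "plateau' \<in> borel_measurable borel" "bump' N j \<in> borel_measurable borel"
    by (auto intro: borel_measurable_continuous_onI continuous_plateau' continuous_bump')
  have "\<bar>plateau' z + bump' N j z\<bar> \<le> 3" for z
  proof -
    have "\<bar>bump' N j z\<bar> \<le> 1"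
      using bump'_bound[of N j z] by (rule order_trans) (simp add: indicator_def)
    then show ?thesis using plateau'_bounds[of z] by linarith
  qed
  then show ?thesis
    unfolding deriv_link_bump_instance[OF assms]
    by (intro integrable_std_normal_bounded[where B = 3]) auto
qed

text \<open>The ramp rises by 1/2 between -1 and 0, where the density is at least its value at 1.
  The slope of the bump may be negative, but costs at most the mass of the bin.\<close>

lemma mu_star_ge:
  assumes N: "N > 0"
  shows "std_normal_density 1 / 2 - std_normal_density 0 / N \<le> mu_star (bump_instance N j)"
proof -
  have [measurable]: "plateau' \<in> borel_measurable borel"
    by (auto intro: borel_measurable_continuous_onI continuous_plateau')
  have [measurable]: "bin N j \<in> sets borel" by (simp add: bin_interval[OF N])
  have ip: "integrable std_normal_distribution plateau'"
    using plateau'_bounds by (intro integrable_std_normal_bounded[where B = 2]) auto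
  have ib: "integrable std_normal_distribution (indicator (bin N j) :: real \<Rightarrow> real)"
    by (intro integrable_std_normal_bounded[where B = 1]) auto
  have FTC: "has_bochner_integral lborel (\<lambda>x. plateau' x * indicator {-1..0} x) (plateau 0 - plateau (-1))"
  proof (rule has_bochner_integral_FTC_Icc_real)
    show "isCont plateau' x" for x
      using continuous_plateau'[of UNIV] by (simp add: continuous_on_eq_continuous_at)
  qed (auto intro: DERIV_plateau)
  have "std_normal_density 1 / 2 = (\<integral>x. std_normal_density 1 * (plateau' x * indicator {-1..0} x) \<partial>lborel)"
    using FTC by (simp add: has_bochner_integral_iff plateau_eq_half) (simp add: plateau_def sqpos_def)
  also have "\<dots> \<le> (\<integral>x. std_normal_density x * plateau' x \<partial>lborel)"
  proof (rule integral_mono)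
    show "integrable lborel (\<lambda>x. std_normal_density 1 * (plateau' x * indicator {-1..0} x))"
      using FTC by (simp add: has_bochner_integral_iff)
    show "integrable lborel (\<lambda>x. std_normal_density x * plateau' x)"
      using ip by (subst (asm) integrable_density) auto
    show "std_normal_density 1 * (plateau' x * indicator {-1..0} x) \<le> std_normal_density x * plateau' x" for x
      using plateau'_bounds[of x] std_normal_density_ge_1[of x]
      by (auto simp: indicator_def intro!: mult_right_mono)
  qed
  also have "\<dots> = (\<integral>x. plateau' x \<partial>std_normal_distribution)"
    by (subst integral_density) auto
  finally have 1: "std_normal_density 1 / 2 \<le> (\<integral>x. plateau' x \<partial>std_normal_distribution)" .
  have "(\<integral>x. plateau' x \<partial>std_normal_distribution) - measure std_normal_distribution (bin N j)
      = (\<integral>x. plateau' x - indicator (bin N j) x \<partial>std_normal_distribution)"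
    using ip ib by (subst Bochner_Integration.integral_diff) auto
  also have "\<dots> \<le> (\<integral>x. deriv (link (bump_instance N j)) x \<partial>std_normal_distribution)"
  proof (rule integral_mono)
    show "plateau' x - indicator (bin N j) x \<le> deriv (link (bump_instance N j)) x" for x
      using bump'_bound[of N j x] by (simp add: deriv_link_bump_instance[OF N])
  qed (use ip ib integrable_deriv_link[OF N] in auto)
  also have "\<dots> = mu_star (bump_instance N j)" by (simp add: mu_star_def)
  finally show ?thesis using 1 measure_bin_le[OF N, of j] by linarith
qed

section \<open>The lower bound\<close>

text \<open>When the core is available the best reward is at least
  \<open>1 / 2 + 1 / (16 * N)\<close>, whereas outside the bin the link never exceeds 1/2.\<close>

lemma regret_ge_miss:
  assumes j: "j < N" and T: "T > 0" and arms: "\<And>t. t \<in> {1..T} \<Longrightarrow> chosen_arm (bump_instance N j) \<pi> u x \<eta> t \<in> {1..K}"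
  shows "real T / (16 * real N) * miss_fraction (bump_instance N j) K T \<pi> (core N j) (bin N j) u x \<eta>
    \<le> regret (bump_instance N j) K T \<pi> u x \<eta>"
proof -
  let ?I = "bump_instance N j"
  let ?f = "link ?I"
  let ?A = "chosen_arm ?I \<pi> u x \<eta>"
  have "1 / (16 * real N) * of_bool (available K (core N j) (x t) \<and> x t (?A t) \<notin> bin N j)
      \<le> Max ((\<lambda>a. ?f (x t a)) ` {1..K}) - ?f (x t (?A t))" if t: "t \<in> {1..T}" for t
  proof -
    let ?M = "Max ((\<lambda>a. ?f (x t a)) ` {1..K})"
    have M: "?f (x t a) \<le> ?M" if "a \<in> {1..K}" for a
      using that by (intro Max_ge) auto
    show ?thesis
    proof (cases "available K (core N j) (x t) \<and> x t (?A t) \<notin> bin N j")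
      case True
      then obtain a where a: "a \<in> {1..K}" "x t a \<in> core N j" by (auto simp: available_def)
      then have "1 / 2 + 1 / (16 * real N) \<le> ?f (x t a)"
        using core_subset[OF j] bump_core[OF a(2)] by (auto simp: plateau_eq_half)
      moreover have "?f (x t (?A t)) \<le> 1 / 2"
        using True plateau_bounds[of "x t (?A t)"] bump_le[of N j "x t (?A t)"] by simp
      ultimately show ?thesis using True M[OF a(1)] by simp
    next
      \<comment> \<open>Here only nonnegativity is claimed, for which the chosen arm has to be among
        those of the maximum.\<close>
      case False
      then show ?thesis using M[OF arms[OF t]] by (simp only: of_bool_eq(1))
    qed
  qed
  then have "(\<Sum>t=1..T. 1 / (16 * real N) * of_bool (available K (core N j) (x t) \<and> x t (?A t) \<notin> bin N j))
      \<le> regret ?I K T \<pi> u x \<eta>"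
    unfolding regret_def by (simp only: bump_instance_simps(1) mult_1_right sum_mono)
  also have "(\<Sum>t=1..T. 1 / (16 * real N) * of_bool (available K (core N j) (x t) \<and> x t (?A t) \<notin> bin N j))
      = real T / (16 * real N) * miss_fraction ?I K T \<pi> (core N j) (bin N j) u x \<eta>"
    using T unfolding miss_fraction_def sum_distrib_left[symmetric] by simp
  finally show ?thesis .
qed

lemma measurable_link_bump_instance: "link (bump_instance N j) \<in> borel_measurable borel"
  unfolding bump_instance_def plateau_def bump_def bin_coord_def divide_inverse
  by (auto intro!: borel_measurable_continuous_onI continuous_intros)

lemma measurable_core_bin: "core N j \<in> sets borel" "bin N j \<in> sets borel"
  unfolding core_def bin_def bin_coord_def by measurable

lemma expected_regret_ge_miss:
  assumes pol: "is_policy K T \<pi>" and j: "j < N" and T: "T > 0"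
  shows "ennreal (real T / (16 * real N)) *
      (\<integral>\<^sup>+(u, x, \<eta>). ennreal (miss_fraction (bump_instance N j) K T \<pi> (core N j) (bin N j) u x \<eta>)
        \<partial>bandit_measure (bump_instance N j) K T)
    \<le> expected_regret (bump_instance N j) K T \<pi>"
proof -
  let ?I = "bump_instance N j"
  let ?m = "miss_fraction ?I K T \<pi> (core N j) (bin N j)"
  have bm: "bandit_measure ?I K T = seed_measure \<Otimes>\<^sub>M contexts K T \<Otimes>\<^sub>M noise T"
    by (rule bandit_measure_std_normal) simp
  have "(\<lambda>(u, x, \<eta>). ?m u x \<eta>) \<in> borel_measurable (seed_measure \<Otimes>\<^sub>M contexts K T \<Otimes>\<^sub>M noise T)"
    by (rule measurable_miss_fraction_bandit[OF pol measurable_link_bump_instance measurable_core_bin])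
  then have m: "(\<lambda>(u, x, \<eta>). ennreal (?m u x \<eta>)) \<in> borel_measurable (bandit_measure ?I K T)"
    unfolding bm by (simp add: case_prod_beta')
  have le: "ennreal (real T / (16 * real N)) * ennreal (?m u x \<eta>) \<le> ennreal (regret ?I K T \<pi> u x \<eta>)"
    if "(u, x, \<eta>) \<in> space (bandit_measure ?I K T)" for u x \<eta>
  proof -
    have u: "u \<in> space seed_measure" and x: "x \<in> space (contexts K T)" and \<eta>: "\<eta> \<in> space (noise T)"
      using that by (auto simp: bm space_pair_measure)
    \<comment> \<open>Validity of the arm at every single point comes from measurability into
      \<open>count_space {1..K}\<close>, which includes mapping space into space.\<close>
    have "chosen_arm ?I \<pi> u x \<eta> t \<in> {1..K}" if t: "t \<in> {1..T}" for t
    proof -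
      have "(\<lambda>\<eta>. chosen_arm ?I \<pi> u x \<eta> t) \<in> noise T \<rightarrow>\<^sub>M count_space {1..K}"
      proof (rule measurable_chosen_arm[where U = "\<lambda>_. u" and X = "\<lambda>_. x" and E = "\<lambda>\<eta>. \<eta>",
            OF pol measurable_link_bump_instance measurable_const[OF u] _ _ t])
        show "(\<lambda>_. x i) \<in> noise T \<rightarrow>\<^sub>M context_space K" if "i \<in> {1..t}" for i
          by (rule measurable_const, rule contexts_component_space[OF x]) (use that t in auto)
        show "(\<lambda>\<eta>. \<eta> i) \<in> borel_measurable (noise T)" if "i \<in> {1..t - 1}" for i
          by (rule measurable_noise_component) (use that t in auto)
      qed
      from measurable_space[OF this \<eta>] show ?thesis by simp
    qed
    from regret_ge_miss[OF j T this] show ?thesis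
      by (simp add: ennreal_mult[symmetric] miss_fraction_bounds ennreal_leI)
  qed
  have "ennreal (real T / (16 * real N)) * (\<integral>\<^sup>+(u, x, \<eta>). ennreal (?m u x \<eta>) \<partial>bandit_measure ?I K T)
      = (\<integral>\<^sup>+\<omega>. ennreal (real T / (16 * real N)) * (case \<omega> of (u, x, \<eta>) \<Rightarrow> ennreal (?m u x \<eta>)) \<partial>bandit_measure ?I K T)"
    by (rule nn_integral_cmult[symmetric]) (rule m)
  also have "\<dots> \<le> expected_regret ?I K T \<pi>"
    unfolding expected_regret_def using le by (intro nn_integral_mono) auto
  finally show ?thesis .
qed

section \<open>Estimates for the numbers of bins and arms, and the choice of constants\<close>

text \<open>The threshold is 10 cubed. Having at least 10 bins absorbs additive constants, the upper
  bound turns \<open>T / N\<close> into the rate, and \<open>T \<le> N^3\<close> controls the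
  information term \<open>T / N^2\<close>.\<close>

lemma num_bumps_bounds:
  assumes T: "T \<ge> 1000"
  shows "10 \<le> num_bumps T" "real (num_bumps T) \<le> 2 * real T powr (1/3)" "real T \<le> real (num_bumps T) ^ 3"
proof -
  let ?r = "real T powr (1/3)"
  have "(1000::real) powr (1/3) = (10 powr 3) powr (1/3)"
    by (simp add: powr_numeral)
  also have "\<dots> = 10" by (simp only: powr_powr) simp
  finally have "10 = (1000::real) powr (1/3)" by simp
  also have "\<dots> \<le> ?r" using T by (intro powr_mono2) auto
  finally have r: "10 \<le> ?r" .
  have N: "real (num_bumps T) = of_int \<lceil>?r\<rceil>"
    using r unfolding num_bumps_def by (simp add: of_nat_nat)
  have le: "?r \<le> real (num_bumps T)" unfolding N by linarith
  show "10 \<le> num_bumps T" using r le by linarith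
  show "real (num_bumps T) \<le> 2 * ?r" using r unfolding N by linarith
  have "real T = ?r ^ 3" using T by (simp add: powr_power)
  also have "\<dots> \<le> real (num_bumps T) ^ 3" using le r by (intro power_mono) auto
  finally show "real T \<le> real (num_bumps T) ^ 3" .
qed

lemma ln_ge_4:
  assumes "T \<ge> 1000"
  shows "4 \<le> ln (real T)"
proof -
  have "exp (4::real) = exp 1 ^ 4" by (simp add: exp_of_nat_mult[symmetric])
  also have "\<dots> \<le> 3 ^ 4" using exp_le by (intro power_mono) auto
  also have "\<dots> \<le> real T" using assms by simp
  finally show ?thesis using assms by (simp add: ln_ge_iff)
qed

text \<open>The number of arms is made so that on average at least \<open>2 * ln T\<close> contexts
  fall into a core.\<close>

lemma num_arms_bump_mass:
  assumes T: "T \<ge> 1000"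
  shows "exp (- (real (num_arms T) * (std_normal_density 1 / (2 * real (num_bumps T))))) \<le> 1 / 4"
proof -
  let ?N = "real (num_bumps T)"
  have N: "?N > 0" using num_bumps_bounds(1)[OF T] by simp
  have p: "p_min > 0" by (simp add: p_min_def normal_density_pos)
  have "4 * ?N * ln (real T) / p_min \<le> real (num_arms T)"
    unfolding num_arms_def by linarith
  then have "4 * ?N * ln (real T) / p_min * (p_min / (2 * ?N)) \<le> real (num_arms T) * (p_min / (2 * ?N))"
    using p N by (intro mult_right_mono) auto
  then have "2 * ln (real T) \<le> real (num_arms T) * (p_min / (2 * ?N))"
    using p N by (simp add: field_simps)
  \<comment> \<open>The value 3 suffices, because \<open>1 + 3 \<le> exp 3\<close> already gives the
    factor 4.\<close>
  then have "3 \<le> real (num_arms T) * (p_min / (2 * ?N))"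
    using ln_ge_4[OF T] by linarith
  then have "4 \<le> exp (real (num_arms T) * (p_min / (2 * ?N)))"
    using exp_ge_add_one_self[of "real (num_arms T) * (p_min / (2 * ?N))"] by linarith
  then show ?thesis unfolding p_min_def exp_minus by (simp add: field_simps)
qed

text \<open>Availability yields 3/4 per bin and the errors take less than 1/2, so the average miss
  fraction exceeds 1/4 and some bin reaches 1/4.\<close>

lemma exists_bump_with_large_regret:
  assumes T: "T \<ge> 1000" and pol: "is_policy (num_arms T) T \<pi>"
  obtains j where "j < num_bumps T"
    "ennreal (1 / 128 * real T powr (2/3)) \<le> expected_regret (bump_instance (num_bumps T) j) (num_arms T) T \<pi>"
proof -
  define N where "N = num_bumps T"
  define K where "K = num_arms T"
  note Nb = num_bumps_bounds[OF T, folded N_def]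
  have N0: "N > 0" and T0: "T > 0" using Nb T by auto
  define E where "E j = (\<integral>\<^sup>+(u, x, \<eta>). ennreal (miss_fraction (bump_instance N j) K T \<pi> (core N j) (bin N j) u x \<eta>)
        \<partial>bandit_measure (bump_instance N j) K T)" for j
  \<comment> \<open>The ramp alone is the common reference for all bins.\<close>
  define I0 where "I0 = \<lparr>param = 1, link = plateau, ctx_dist = std_normal_distribution\<rparr>"
  \<comment> \<open>The error total for \<open>l = 8\<close> and drift at most
    \<open>1 / (8 * N)\<close>. It equals \<open>N / 8 + 9 / 128 * (T / N^2) + 1\<close>, below
    \<open>N / 2\<close> since \<open>T / N^2 \<le> N\<close> and \<open>10 \<le> N\<close>.\<close>
  define r where "r = real N / 8 + ((8 + 1) / 2 * (1 / (8 * real N))\<^sup>2 + 1 / real T) * real T"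
  have "exp (- (real K * (std_normal_density 1 / (2 * real N)))) \<le> 1 / 4"
    using num_arms_bump_mass[OF T] by (simp add: N_def K_def)
  then have avail: "ennreal (3 / 4) \<le> (\<integral>\<^sup>+y. ennreal (of_bool (available K (core N j) y)) \<partial>noise K)"
    if "j < N" for j
    by (intro order_trans[OF _ prob_available_ge[OF measurable_core_bin(1) emeasure_core_ge[OF that]]])
      (auto intro!: ennreal_leI)
  have "ennreal (real N * (3 / 4)) \<le> (\<Sum>j<N. E j) + ennreal r"
    unfolding E_def r_def
  proof (rule sum_expected_miss_ge[where I = I0 and J = "bump_instance N" and p = "3/4" and l = 8])
    show "is_policy K T \<pi>" using pol by (simp add: K_def)
    show "link I0 \<in> borel_measurable borel"
      unfolding I0_def plateau_def
      by (auto intro!: borel_measurable_continuous_onI continuous_intros)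
    show "\<bar>link (bump_instance N j) z - link I0 z\<bar> \<le> 1 / (8 * real N) * of_bool (z \<in> bin N j)" for j z
      using bump_nonneg[of N j z] bump_le[of N j z] by (simp add: I0_def)
    show "disjoint_family_on (bin N) {..<N}"
      using disjoint_bins[OF N0] by (auto simp: disjoint_family_on_def)
  qed (use avail T0 measurable_link_bump_instance measurable_core_bin in \<open>auto simp: I0_def\<close>)
  moreover have "r < real N / 2"
  proof -
    have "real T / real N ^ 2 \<le> real N"
      using Nb(3) N0 by (simp add: divide_le_eq power2_eq_square power3_eq_cube)
    moreover have "r = real N / 8 + 9 / 128 * (real T / real N ^ 2) + 1"
      using T0 N0 by (simp add: r_def field_simps power2_eq_square)
    ultimately show ?thesis using Nb(1) by linarith
  qed
  ultimately have "\<not> (\<Sum>j<N. E j) \<le> ennreal (real N / 4)"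
  proof (intro notI)
    assume "(\<Sum>j<N. E j) \<le> ennreal (real N / 4)" and r: "r < real N / 2"
      and "ennreal (real N * (3 / 4)) \<le> (\<Sum>j<N. E j) + ennreal r"
    then have "ennreal (real N * (3 / 4)) \<le> ennreal (real N / 4) + ennreal r"
      by (meson add_right_mono order_trans)
    moreover have r0: "r \<ge> 0" by (simp add: r_def)
    ultimately have "real N * (3 / 4) \<le> real N / 4 + r"
      by (simp add: ennreal_plus[symmetric] del: ennreal_plus)
    with r show False by linarith
  qed
  moreover have "(\<Sum>j<N. E j) \<le> ennreal (real N / 4)" if "\<And>j. j < N \<Longrightarrow> E j \<le> ennreal (1 / 4)"
  proof -
    have "(\<Sum>j<N. E j) \<le> (\<Sum>j<N. ennreal (1 / 4))" by (rule sum_mono) (use that in auto)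
    also have "\<dots> = ennreal (real N / 4)"
      by (simp add: ennreal_of_nat_eq_real_of_nat ennreal_mult[symmetric])
    finally show ?thesis .
  qed
  ultimately obtain j where j: "j < N" "ennreal (1 / 4) \<le> E j"
    by (meson linear)
  \<comment> \<open>The constant is 1/16 from half the bump height, times 1/4 from the miss
    fraction, times 1/2 from \<open>N \<le> 2 * T powr (1/3)\<close>.\<close>
  have "1 / 128 * real T powr (2/3) \<le> real T / (16 * real N) * (1 / 4)"
  proof -
    have "real T = real T powr (1/3) * real T powr (2/3)"
      using T0 by (simp add: powr_add[symmetric])
    then have "real T powr (2/3) * real N \<le> 2 * real T"
      using mult_right_mono[OF Nb(2), of "real T powr (2/3)"] by (simp add: mult_ac)
    then show ?thesis using N0 by (simp add: field_simps)
  qed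
  then have "ennreal (1 / 128 * real T powr (2/3)) \<le> ennreal (real T / (16 * real N)) * ennreal (1 / 4)"
    by (simp add: ennreal_mult[symmetric] ennreal_leI)
  also have "\<dots> \<le> ennreal (real T / (16 * real N)) * E j"
    by (rule mult_left_mono[OF j(2)]) simp
  also have "\<dots> \<le> expected_regret (bump_instance N j) K T \<pi>"
    unfolding E_def by (rule expected_regret_ge_miss) (use pol j T0 in \<open>auto simp: K_def\<close>)
  finally show ?thesis using j(1) that by (simp add: N_def K_def)
qed

theorem theorem2:
  shows "\<exists>c::real. c > 0 \<and> (\<exists>T\<^sub>0::nat.
    \<forall>(\<rho>::real \<Rightarrow> real) (C\<^sub>W::real) (\<delta>::real) (L::real) (L'::real).
      is_transition \<rho> \<and> C\<^sub>W > 0 \<and> 0 < \<delta> \<and> \<delta> < 1 \<and> L \<ge> 1 \<and> L' \<ge> 3 \<longrightarrow>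
      (\<forall>T\<ge>T\<^sub>0. \<forall>\<pi>. is_policy (num_arms T) T \<pi> \<longrightarrow>
         (SUP I \<in> {I :: sib_instance. valid_instance 1 C\<^sub>W \<delta> L L' (num_arms T) T I \<and>
                       param I = 1 \<and>
                       ctx_dist I = density lborel std_normal_density \<and>
                       integrable (ctx_dist I) (\<lambda>x. deriv (link I) (x * param I)) \<and>
                       mu_star I \<ge> c\<^sub>1 \<rho> / (2 * ln (real T))}.
            expected_regret I (num_arms T) T \<pi>)
         \<ge> ennreal (c * real T powr (2/3))))"
proof (intro exI[of _ "1 / 128"] exI[of _ 1000] conjI allI impI)
  fix \<rho> :: "real \<Rightarrow> real" and C\<^sub>W \<delta> L L' :: real and T :: nat and \<pi> :: policy
  assume par: "is_transition \<rho> \<and> C\<^sub>W > 0 \<and> 0 < \<delta> \<and> \<delta> < 1 \<and> L \<ge> 1 \<and> L' \<ge> 3"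
    and T: "1000 \<le> T" and pol: "is_policy (num_arms T) T \<pi>"
  \<comment> \<open>The bin depends on \<open>\<pi>\<close>, as it may: the supremum is taken for
    each policy separately.\<close>
  obtain j where j: "j < num_bumps T" and
    reg: "ennreal (1 / 128 * real T powr (2/3))
      \<le> expected_regret (bump_instance (num_bumps T) j) (num_arms T) T \<pi>"
    using exists_bump_with_large_regret[OF T pol] .
  let ?I = "bump_instance (num_bumps T) j"
  have N: "num_bumps T > 0" using num_bumps_bounds(1)[OF T] by simp
  \<comment> \<open>All terms are compared with the density at 0: the left side is at most 1/8 of
    it, since \<open>2 * ln T \<ge> 8\<close>, and the right side at least 1/4 - 1/10 of it, since
    the density at 1 is at least half that at 0 and \<open>N \<ge> 10\<close>.\<close>
  have "c\<^sub>1 \<rho> / (2 * ln (real T)) \<le> mu_star ?I"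
  proof -
    have ln: "8 \<le> 2 * ln (real T)" using ln_ge_4[OF T] by simp
    have \<phi>: "std_normal_density 0 > 0" by (simp add: normal_density_pos)
    have "c\<^sub>1 \<rho> / (2 * ln (real T)) \<le> std_normal_density 0 / (2 * ln (real T))"
      using c1_le par ln by (intro divide_right_mono) auto
    also have "\<dots> \<le> std_normal_density 0 / 8"
      using ln \<phi> by (intro divide_left_mono) auto
    also have "\<dots> \<le> std_normal_density 0 / 4 - std_normal_density 0 / 10" using \<phi> by simp
    also have "\<dots> \<le> std_normal_density 1 / 2 - std_normal_density 0 / num_bumps T"
      using std_normal_density_1_ge num_bumps_bounds(1)[OF T] \<phi>
        divide_left_mono[of 10 "real (num_bumps T)" "std_normal_density 0"] by auto
    also have "\<dots> \<le> mu_star ?I" by (rule mu_star_ge[OF N])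
    finally show ?thesis .
  qed
  moreover have "valid_instance 1 C\<^sub>W \<delta> L L' (num_arms T) T ?I"
    using valid_ctx_dist_std_normal valid_link_bump_instance[OF N] par
    by (simp add: valid_instance_def)
  moreover have "integrable (ctx_dist ?I) (\<lambda>x. deriv (link ?I) (x * param ?I))"
    using integrable_deriv_link[OF N] by simp
  ultimately show "ennreal (1 / 128 * real T powr (2/3)) \<le>
      (SUP I \<in> {I :: sib_instance. valid_instance 1 C\<^sub>W \<delta> L L' (num_arms T) T I \<and>
                       param I = 1 \<and>
                       ctx_dist I = density lborel std_normal_density \<and>
                       integrable (ctx_dist I) (\<lambda>x. deriv (link I) (x * param I)) \<and>
                       mu_star I \<ge> c\<^sub>1 \<rho> / (2 * ln (real T))}.
            expected_regret I (num_arms T) T \<pi>)"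
    using reg by (intro SUP_upper2[of ?I]) auto
qed simp

end
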